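(* Let $X$ be a Valdivia compact space and let $f\colon X\to Y$ be a map such that either $f$ is a retraction, or $Y$ is $0$-dimensional and $f$ is an open surjection. If the weight of $Y$ satisfies $\mathrm{w}(Y)\le\aleph_1$, then $Y$ is Valdivia compact.
   Context: All spaces are Hausdorff and "map" means continuous map. For a set $T$, $\Sigma(T)=\{x\in[0,1]^T: \{\alpha\in T: x(\alpha)\neq 0\}\text{ is countable}\}$. A compact space $X$ is Valdivia compact if for some set $T$ there is an embedding $h\colon X\to[0,1]^T$ with $h[X]=\operatorname{cl}(\Sigma(T)\cap h[X])$, the closure being taken in $[0,1]^T$. A retraction is a map $f\colon X\to Y$ having a right inverse, i.e. a map $g\colon Y\to X$ with $fg=\mathrm{id}_Y$. The weight $\mathrm{w}(Y)$ is the least cardinality of an open base of $Y$. *)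

theory Defs
  imports "HOL-Analysis.Analysis"
begin

unbundle cardinal_syntax

definition cube :: "'i set \<Rightarrow> ('i \<Rightarrow> real) topology" where
  "cube T = product_topology (\<lambda>_. top_of_set {0..1}) T"

definition sigma_product :: "'i set \<Rightarrow> ('i \<Rightarrow> real) set" where
  "sigma_product T = {x \<in> topspace (cube T). countable {\<alpha> \<in> T. x \<alpha> \<noteq> 0}}"

definition valdivia_embedding :: "'a topology \<Rightarrow> 'i set \<Rightarrow> ('a \<Rightarrow> 'i \<Rightarrow> real) \<Rightarrow> bool" where
  "valdivia_embedding X T h \<longleftrightarrow>
     embedding_map X (cube T) h \<and>
     h ` topspace X = cube T closure_of (sigma_product T \<inter> h ` topspace X)"

text \<open>The index set \<open>T\<close> of a Valdivia compact space is an arbitrary set. HOL has no quantifier over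
  types, so \<open>T\<close> ranges over subsets of the type of functions \<open>X \<rightarrow> \<real>\<close>. This loses nothing:
  coordinates inducing the same function on \<open>X\<close> can be identified, see
  \<open>valdivia_compactI\<close> below, where the type of the index set is arbitrary.\<close>

definition valdivia_compact :: "'a topology \<Rightarrow> bool" where
  "valdivia_compact X \<longleftrightarrow>
     compact_space X \<and> Hausdorff_space X \<and>
     (\<exists>(T :: ('a \<Rightarrow> real) set) h. valdivia_embedding X T h)"

definition open_base :: "'a topology \<Rightarrow> 'a set set \<Rightarrow> bool" where
  "open_base X B \<longleftrightarrow> openin X = arbitrary union_of (\<lambda>U. U \<in> B)"

text \<open>As usual for the cardinals of \<^theory>\<open>HOL.BNF_Cardinal_Order_Relation\<close>, the weight is a
  cardinal order determined up to \<open>=o\<close>.\<close>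

definition weight :: "'a topology \<Rightarrow> 'a set rel" where
  "weight X = |SOME B. open_base X B \<and> (\<forall>B'. open_base X B' \<longrightarrow> |B| \<le>o |B'| )|"

abbreviation aleph_1 :: "nat set rel" where
  "aleph_1 \<equiv> cardSuc natLeq"

lemma topspace_cube: "topspace (cube T) = (\<Pi>\<^sub>E _\<in>T. {0..1})"
  by (simp add: cube_def)

lemma continuous_map_reindex:
  assumes "s ` T' \<subseteq> T"
  shows "continuous_map (cube T) (cube T') (\<lambda>y. \<lambda>\<beta>\<in>T'. y (s \<beta>))"
  unfolding cube_def using assms
  by (subst continuous_map_componentwise)
     (auto simp: intro!: continuous_map_product_projection)

lemma valdivia_compactI:
  fixes T :: "'i set"
  assumes X: "compact_space X" "Hausdorff_space X" and V: "valdivia_embedding X T h"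
  shows "valdivia_compact X"
proof -
  define F where "F = (\<lambda>\<alpha>. \<lambda>x\<in>topspace X. h x \<alpha>)"
  define T' where "T' = F ` T"
  define s where "s = inv_into T F"
  define R :: "('i \<Rightarrow> real) \<Rightarrow> ('a \<Rightarrow> real) \<Rightarrow> real" where "R = (\<lambda>y. \<lambda>\<beta>\<in>T'. y (s \<beta>))"
  define Q :: "(('a \<Rightarrow> real) \<Rightarrow> real) \<Rightarrow> 'i \<Rightarrow> real" where "Q = (\<lambda>z. \<lambda>\<alpha>\<in>T. z (F \<alpha>))"
  have emb: "embedding_map X (cube T) h"
    and cl: "h ` topspace X = cube T closure_of (sigma_product T \<inter> h ` topspace X)"
    using V by (auto simp: valdivia_embedding_def)
  have conth: "continuous_map X (cube T) h"
    using emb by (simp add: embedding_map_def homeomorphic_eq_everything_map continuous_map_in_subtopology)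
  have injh: "inj_on h (topspace X)"
    using emb by (simp add: embedding_map_def homeomorphic_eq_everything_map)
  have s: "s \<beta> \<in> T" "F (s \<beta>) = \<beta>" if "\<beta> \<in> T'" for \<beta>
    using that by (simp_all add: s_def T'_def inv_into_into f_inv_into_f)
  have contR: "continuous_map (cube T) (cube T') R"
    unfolding R_def using s by (intro continuous_map_reindex) auto
  define h' where "h' = R \<circ> h"
  have h'_app: "h' x \<beta> = \<beta> x" if "x \<in> topspace X" "\<beta> \<in> T'" for x \<beta>
  proof -
    have "F (s \<beta>) x = \<beta> x" using s that by simp
    then show ?thesis using that by (simp add: h'_def R_def F_def)
  qed
  have Qh': "Q (h' x) = h x" if "x \<in> topspace X" for x
  proof
    fix \<alpha>
    have "h x \<in> topspace (cube T)"
      using conth that continuous_map_image_subset_topspace by fastforce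
    then have "h x \<alpha> = undefined" if "\<alpha> \<notin> T"
      using that by (auto simp: topspace_cube PiE_def extensional_def)
    moreover have "h' x (F \<alpha>) = h x \<alpha>" if "\<alpha> \<in> T"
      using that \<open>x \<in> topspace X\<close> by (subst h'_app) (auto simp: T'_def F_def)
    ultimately show "Q (h' x) \<alpha> = h x \<alpha>"
      by (simp add: Q_def)
  qed
  have conth': "continuous_map X (cube T') h'"
    unfolding h'_def using conth contR by (rule continuous_map_compose)
  have injh': "inj_on h' (topspace X)"
    by (metis (no_types, lifting) Qh' injh inj_on_def)
  have Haus: "Hausdorff_space (cube T')"
    by (auto simp: cube_def Hausdorff_space_product_topology intro!: Hausdorff_space_subtopology)
  have emb': "embedding_map X (cube T') h'"
    using conth' injh' X Haus continuous_imp_closed_map injective_closed_imp_embedding_map by blast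
  have "closedin (cube T') (h' ` topspace X)"
    using X conth' Haus by (metis compact_space_def compactin_imp_closedin image_compactin)
  then have "cube T' closure_of (sigma_product T' \<inter> h' ` topspace X) \<subseteq> h' ` topspace X"
    by (intro closure_of_minimal) auto
  moreover have "h' ` topspace X \<subseteq> cube T' closure_of (sigma_product T' \<inter> h' ` topspace X)"
  proof -
    have "h' ` topspace X = R ` (cube T closure_of (sigma_product T \<inter> h ` topspace X))"
      by (subst cl[symmetric]) (simp add: h'_def image_comp)
    also have "\<dots> \<subseteq> cube T' closure_of (R ` (sigma_product T \<inter> h ` topspace X))"
      using contR by (rule continuous_map_image_closure_subset)
    also have "\<dots> \<subseteq> cube T' closure_of (sigma_product T' \<inter> h' ` topspace X)"
    proof (intro closure_of_mono subsetI)
      fix z assume "z \<in> R ` (sigma_product T \<inter> h ` topspace X)"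
      then obtain y where y: "y \<in> sigma_product T" "y \<in> h ` topspace X" "z = R y" by blast
      have "{\<beta> \<in> T'. R y \<beta> \<noteq> 0} \<subseteq> F ` {\<alpha> \<in> T. y \<alpha> \<noteq> 0}"
      proof
        fix \<beta> assume "\<beta> \<in> {\<beta> \<in> T'. R y \<beta> \<noteq> 0}"
        then have "\<beta> = F (s \<beta>)" "s \<beta> \<in> {\<alpha> \<in> T. y \<alpha> \<noteq> 0}"
          using s[of \<beta>] by (auto simp: R_def)
        then show "\<beta> \<in> F ` {\<alpha> \<in> T. y \<alpha> \<noteq> 0}"
          by (rule image_eqI)
      qed
      moreover have "countable (F ` {\<alpha> \<in> T. y \<alpha> \<noteq> 0})"
        using y(1) by (intro countable_image) (simp add: sigma_product_def)
      ultimately have "countable {\<beta> \<in> T'. R y \<beta> \<noteq> 0}"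
        by (rule countable_subset)
      moreover have "R y \<in> topspace (cube T')"
      proof -
        have "y \<in> topspace (cube T)"
          using y(1) by (simp add: sigma_product_def)
        with contR show ?thesis
          unfolding continuous_map_def by blast
      qed
      ultimately have "R y \<in> sigma_product T'"
        unfolding sigma_product_def by blast
      moreover have "R y \<in> h' ` topspace X"
        using y(2) unfolding h'_def by (metis image_comp image_eqI)
      ultimately show "z \<in> sigma_product T' \<inter> h' ` topspace X"
        using y(3) by blast
    qed
    finally show ?thesis .
  qed
  ultimately have "valdivia_embedding X T' h'"
    using emb' by (auto simp: valdivia_embedding_def)
  then show ?thesis
    using X by (auto simp: valdivia_compact_def)
qed

lemma weight_attained:
  obtains B where "open_base X B" "weight X = |B|"
    "\<And>B'. open_base X B' \<Longrightarrow> |B| \<le>o |B'|"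
proof -
  let ?P = "\<lambda>B. open_base X B \<and> (\<forall>B'. open_base X B' \<longrightarrow> |B| \<le>o |B'| )"
  have "open_base X {U. openin X U}"
    unfolding open_base_def
    by (subst openin_topology_base_unique) auto
  then have "(\<lambda>B. |B| ) ` {B. open_base X B} \<noteq> {}" by blast
  then have "\<exists>B. ?P B"
    using exists_minim_Card_order[of "(\<lambda>B. |B| ) ` {B. open_base X B}"] card_of_Card_order by blast
  then have "?P (SOME B. ?P B)" by (rule someI_ex)
  then show thesis using that unfolding weight_def by blast
qed

lemma weight_le_iff: "weight X \<le>o r \<longleftrightarrow> (\<exists>B. open_base X B \<and> |B| \<le>o r)"
  by (metis weight_attained ordLeq_transitive)

end

theory Submission
  imports Defs
begin

text \<open>
  A Valdivia embedding amounts to a family \<open>T\<close> of continuous functions \<open>X \<rightarrow> [0,1]\<close> that separates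
  points and is such that the points at which only countably many members of \<open>T\<close> do not vanish are
  dense. For suitably closed sets \<open>S \<subseteq> T\<close>, setting the coordinates outside \<open>S\<close> to zero is a
  retraction \<open>\<rho>\<^sub>S\<close> of \<open>X\<close>.

  Each \<open>S\<close> determines a set \<open>E\<^sub>S\<close> of functions on \<open>Y\<close>, hence a quotient \<open>Y\<^sub>S\<close> of \<open>Y\<close>, in such a way that
  \<open>Y \<rightarrow> Y\<^sub>S\<close> has a continuous section for countable closed \<open>S\<close>. If \<open>f\<close> is a retraction with right inverse
  \<open>g\<close>, then \<open>E\<^sub>S\<close> consists of the functions \<open>t \<circ> g\<close> with \<open>t \<in> S\<close>, and \<open>f \<circ> \<rho>\<^sub>S \<circ> g\<close> is the
  projection followed by the section. If \<open>f\<close> is open and \<open>Y\<close> is zero-dimensional, then \<open>E\<^sub>S\<close> consists of indicator functions of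
  clopen sets squeezed between images of boxes; this makes \<open>\<rho>\<^sub>S X \<rightarrow> Y\<^sub>S\<close> open, and a zero-dimensional
  selection argument applies.

  As \<open>Y\<close> has weight at most \<open>\<aleph>\<^sub>1\<close>, it is the limit of a continuous increasing sequence of such
  quotients along a well-order with countable initial segments. The sections for different \<open>S\<close> need not
  be compatible, but the maps \<open>P\<^sub>a\<close> they induce on \<open>Y\<close> are only needed one step at a time: for \<open>e\<close>
  appearing at step \<open>a\<close>, the positive and negative parts of \<open>e - e \<circ> P\<^sub>a\<close> separate points and vanish
  at all late steps on a dense set of points, found by transfinite induction and compactness.
\<close>

section \<open>Separating families of functions\<close>

definition coordinates :: "'a topology \<Rightarrow> ('a \<Rightarrow> real) set \<Rightarrow> bool" where
  "coordinates X T \<longleftrightarrow>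
     (\<forall>t\<in>T. continuous_map X euclideanreal t) \<and>
     (\<forall>x\<in>topspace X. \<forall>y\<in>topspace X. (\<forall>t\<in>T. t x = t y) \<longrightarrow> x = y)"

lemma coordinates_continuous: "coordinates X T \<Longrightarrow> t \<in> T \<Longrightarrow> continuous_map X euclideanreal t"
  by (simp add: coordinates_def)

lemma coordinates_eqI:
  "coordinates X T \<Longrightarrow> x \<in> topspace X \<Longrightarrow> y \<in> topspace X \<Longrightarrow> (\<And>t. t \<in> T \<Longrightarrow> t x = t y) \<Longrightarrow> x = y"
  by (auto simp: coordinates_def)

section \<open>Compactness arguments for separating families\<close>

lemma closedin_eq_level:
  fixes t :: "'a \<Rightarrow> real"
  assumes "continuous_map X euclideanreal t"
  shows "closedin X {x \<in> topspace X. t x = c}"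
  using closedin_continuous_map_preimage[OF assms, of "{c}"] by simp

lemma openin_greater_level:
  fixes t :: "'a \<Rightarrow> real"
  assumes "continuous_map X euclideanreal t"
  shows "openin X {x \<in> topspace X. t x > c}"
  using openin_continuous_map_preimage[OF assms, of "{c<..}"] by simp

lemma openin_less_level:
  fixes t :: "'a \<Rightarrow> real"
  assumes "continuous_map X euclideanreal t"
  shows "openin X {x \<in> topspace X. t x < c}"
  using openin_continuous_map_preimage[OF assms, of "{..<c}"] by simp

text \<open>Directedness puts a member of the family below every finite intersection, so the finite
  intersection property holds.\<close>

lemma compact_space_directed_Inter:
  assumes "compact_space X" and "\<C> \<noteq> {}"
    and closed: "\<And>C. C \<in> \<C> \<Longrightarrow> closedin X C" and ne: "\<And>C. C \<in> \<C> \<Longrightarrow> C \<noteq> {}"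
    and dir: "\<And>C C'. C \<in> \<C> \<Longrightarrow> C' \<in> \<C> \<Longrightarrow> \<exists>C''\<in>\<C>. C'' \<subseteq> C \<inter> C'"
  shows "\<Inter>\<C> \<noteq> {}"
proof -
  have "\<exists>C\<in>\<C>. C \<subseteq> \<Inter>\<F>" if "finite \<F>" "\<F> \<subseteq> \<C>" for \<F>
    using that
  proof induction
    case empty
    then show ?case using \<open>\<C> \<noteq> {}\<close> by auto
  next
    case (insert C \<F>)
    then obtain C' where "C' \<in> \<C>" "C' \<subseteq> \<Inter>\<F>" by auto
    moreover obtain C'' where "C'' \<in> \<C>" "C'' \<subseteq> C \<inter> C'"
      using dir[of C C'] insert.prems \<open>C' \<in> \<C>\<close> by auto
    ultimately show ?case by (intro bexI[of _ C'']) auto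
  qed
  then have "\<forall>\<F>. finite \<F> \<and> \<F> \<subseteq> \<C> \<longrightarrow> \<Inter>\<F> \<noteq> {}"
    using ne by (metis subset_empty)
  with assms(1) closed show ?thesis
    unfolding compact_space_fip by blast
qed

text \<open>The open sets where some \<open>v i\<close> exceeds \<open>1 / real (Suc n)\<close> in
  absolute value cover \<open>A\<close>. A finite subcover names the indices, and the largest
  \<open>n\<close> occurring in it gives a uniform bound.\<close>

lemma compactin_finite_nonvanishing:
  fixes v :: "'i \<Rightarrow> 'a \<Rightarrow> real"
  assumes "compactin X A" and cont: "\<And>i. i \<in> I \<Longrightarrow> continuous_map X euclideanreal (v i)"
    and nz: "\<And>x. x \<in> A \<Longrightarrow> \<exists>i\<in>I. v i x \<noteq> 0"
  shows "\<exists>F \<epsilon>. finite F \<and> F \<subseteq> I \<and> \<epsilon> > 0 \<and> (\<forall>x\<in>A. \<exists>i\<in>F. \<bar>v i x\<bar> > \<epsilon>)"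
proof -
  define W where "W = (\<lambda>(i,n). {x \<in> topspace X. \<bar>v i x\<bar> > 1 / real (Suc n)})"
  have "openin X (W p)" if "p \<in> I \<times> UNIV" for p
    using that unfolding W_def
    by (auto intro!: openin_greater_level continuous_map_real_abs cont)
  moreover have "A \<subseteq> \<Union> (W ` (I \<times> UNIV))"
  proof
    fix x assume "x \<in> A"
    then obtain i where i: "i \<in> I" "v i x \<noteq> 0" using nz by blast
    then obtain n where "1 / real (Suc n) < \<bar>v i x\<bar>"
      by (meson nat_approx_posE zero_less_abs_iff)
    moreover have "x \<in> topspace X"
      using \<open>x \<in> A\<close> assms(1) compactin_subset_topspace by blast
    ultimately show "x \<in> \<Union> (W ` (I \<times> UNIV))"
      using i by (auto simp: W_def)
  qed
  ultimately obtain \<F> where \<F>: "finite \<F>" "\<F> \<subseteq> W ` (I \<times> UNIV)" "A \<subseteq> \<Union>\<F>"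
    using assms(1) unfolding compactin_def by (metis (no_types, lifting) imageE)
  then obtain G where G: "finite G" "G \<subseteq> I \<times> UNIV" "\<F> = W ` G"
    by (meson finite_subset_image)
  then obtain N where N: "\<forall>n\<in>snd ` G. n \<le> N"
    using finite_nat_set_iff_bounded_le by (metis finite_imageI)
  show ?thesis
  proof (intro exI conjI ballI)
    show "finite (fst ` G)" "fst ` G \<subseteq> I" "1 / real (Suc N) > 0"
      using G by auto
    fix x assume "x \<in> A"
    then obtain i n where p: "(i,n) \<in> G" "\<bar>v i x\<bar> > 1 / real (Suc n)"
      using \<F>(3) G(3) by (auto simp: W_def)
    with N have "n \<le> N" by force
    then have "1 / real (Suc N) \<le> 1 / real (Suc n)"
      by (simp add: frac_le)
    with p show "\<exists>i\<in>fst ` G. \<bar>v i x\<bar> > 1 / real (Suc N)"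
      by force
  qed
qed

text \<open>On a compact space a separating family induces the topology: off \<open>U\<close> the
  differences \<open>t y - t x\<close> have no common zero, so finitely many of them are uniformly
  bounded away from zero there.\<close>

lemma coordinates_neighbourhood:
  assumes "compact_space X" "coordinates X T" "openin X U" "x \<in> U"
  obtains F \<epsilon> where "finite F" "F \<subseteq> T" "\<epsilon> > 0"
    "\<And>y. y \<in> topspace X \<Longrightarrow> (\<And>t. t \<in> F \<Longrightarrow> \<bar>t y - t x\<bar> \<le> \<epsilon>) \<Longrightarrow> y \<in> U"
proof -
  have x: "x \<in> topspace X"
    using assms(3,4) openin_subset by blast
  have "compactin X (topspace X - U)"
    using assms(1,3) by (intro closedin_compact_space closedin_diff closedin_topspace)
  moreover have "continuous_map X euclideanreal (\<lambda>y. t y - t x)" if "t \<in> T" for t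
    by (intro continuous_map_diff coordinates_continuous[OF assms(2) that]) simp
  moreover have "\<exists>t\<in>T. t y - t x \<noteq> 0" if "y \<in> topspace X - U" for y
  proof (rule ccontr)
    assume "\<not> ?thesis"
    then have "y = x"
      using that x assms(2) by (intro coordinates_eqI[of X T]) auto
    then show False using that assms(4) by auto
  qed
  ultimately have "\<exists>F \<epsilon>. finite F \<and> F \<subseteq> T \<and> \<epsilon> > 0 \<and> (\<forall>y\<in>topspace X - U. \<exists>t\<in>F. \<bar>t y - t x\<bar> > \<epsilon>)"
    by (rule compactin_finite_nonvanishing)
  then obtain F \<epsilon> where F: "finite F" "F \<subseteq> T" "\<epsilon> > 0" "\<forall>y\<in>topspace X - U. \<exists>t\<in>F. \<bar>t y - t x\<bar> > \<epsilon>"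
    by blast
  show thesis
    by (rule that[OF F(1-3)]) (use F(4) in \<open>force simp: not_less[symmetric]\<close>)
qed

lemma continuous_map_coordinatesI:
  assumes "compact_space X" "coordinates X T"
    and into: "\<And>z. z \<in> topspace Z \<Longrightarrow> g z \<in> topspace X"
    and cont: "\<And>t. t \<in> T \<Longrightarrow> continuous_map Z euclideanreal (\<lambda>z. t (g z))"
  shows "continuous_map Z X g"
  unfolding continuous_map_def
proof (intro conjI allI impI)
  show "g \<in> topspace Z \<rightarrow> topspace X" using into by auto
  fix U assume U: "openin X U"
  show "openin Z {z \<in> topspace Z. g z \<in> U}"
  proof (subst openin_subopen, intro ballI)
    fix z assume "z \<in> {z \<in> topspace Z. g z \<in> U}"
    then have z: "z \<in> topspace Z" "g z \<in> U" by auto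
    obtain F \<epsilon> where F: "finite F" "F \<subseteq> T" "\<epsilon> > 0"
      "\<And>y. y \<in> topspace X \<Longrightarrow> (\<And>t. t \<in> F \<Longrightarrow> \<bar>t y - t (g z)\<bar> \<le> \<epsilon>) \<Longrightarrow> y \<in> U"
      using coordinates_neighbourhood[OF assms(1,2) U z(2)] by metis
    \<comment> \<open>The factor \<open>topspace Z\<close> keeps \<open>V\<close> inside the space
      when \<open>F\<close> is empty.\<close>
    define V where "V = topspace Z \<inter> \<Inter> ((\<lambda>t. {w \<in> topspace Z. \<bar>t (g w) - t (g z)\<bar> < \<epsilon>}) ` F)"
    have "openin Z {w \<in> topspace Z. \<bar>t (g w) - t (g z)\<bar> < \<epsilon>}" if "t \<in> F" for t
      using cont[of t] that F(2)
      by (intro openin_less_level continuous_map_real_abs continuous_map_diff) auto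
    then have "openin Z V"
      unfolding V_def using F(1) by (intro openin_Int_Inter) auto
    moreover have "z \<in> V" using z F(3) by (auto simp: V_def)
    moreover have "V \<subseteq> {z \<in> topspace Z. g z \<in> U}"
    proof
      fix w assume w: "w \<in> V"
      then have "g w \<in> U"
        by (intro F(4) into) (auto simp: V_def intro: less_imp_le)
      with w show "w \<in> {z \<in> topspace Z. g z \<in> U}" by (auto simp: V_def)
    qed
    ultimately show "\<exists>V. openin Z V \<and> z \<in> V \<and> V \<subseteq> {z \<in> topspace Z. g z \<in> U}" by blast
  qed
qed

text \<open>The pairs at which \<open>k\<close> differs by at least \<open>1 / real (Suc n)\<close>
  form a compact set \<open>A n\<close> in the square, on which finitely many coordinates separate
  the two entries. \<open>C\<close> is the union of these finite sets over all
  \<open>n\<close>.\<close>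

lemma continuous_map_depends_countable:
  fixes k :: "'a \<Rightarrow> real"
  assumes "compact_space X" "coordinates X T" "continuous_map X euclideanreal k"
  shows "\<exists>C. countable C \<and> C \<subseteq> T \<and>
    (\<forall>x\<in>topspace X. \<forall>y\<in>topspace X. (\<forall>t\<in>C. t x = t y) \<longrightarrow> k x = k y)"
proof -
  let ?XX = "prod_topology X X"
  have cont: "continuous_map ?XX euclideanreal (\<lambda>p. h (fst p) - h (snd p))"
    if "continuous_map X euclideanreal h" for h
    using that continuous_map_compose[OF continuous_map_fst that, of X]
      continuous_map_compose[OF continuous_map_snd that, of X]
    by (intro continuous_map_diff) (simp_all add: o_def)
  define A where "A n = {p \<in> topspace ?XX. \<bar>k (fst p) - k (snd p)\<bar> \<in> {1 / real (Suc n)..}}" for n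
  have "\<exists>F. finite F \<and> F \<subseteq> T \<and> (\<forall>p\<in>A n. \<exists>t\<in>F. t (fst p) \<noteq> t (snd p))" for n
  proof -
    have "closedin ?XX (A n)"
      unfolding A_def using cont[OF assms(3)]
      by (intro closedin_continuous_map_preimage[where Y=euclideanreal] continuous_map_real_abs)
        (auto simp: o_def)
    then have "compactin ?XX (A n)"
      using assms(1) by (simp add: closedin_compact_space compact_space_prod_topology)
    moreover have "continuous_map ?XX euclideanreal (\<lambda>p. t (fst p) - t (snd p))" if "t \<in> T" for t
      using that by (intro cont coordinates_continuous[OF assms(2)])
    moreover have "\<exists>t\<in>T. t (fst p) - t (snd p) \<noteq> 0" if "p \<in> A n" for p
    proof (rule ccontr)
      assume "\<not> ?thesis"
      then have "fst p = snd p"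
        using that assms(2) by (intro coordinates_eqI[of X T]) (auto simp: A_def)
      then show False using that by (auto simp: A_def)
    qed
    ultimately have "\<exists>F \<epsilon>. finite F \<and> F \<subseteq> T \<and> \<epsilon> > 0 \<and> (\<forall>p\<in>A n. \<exists>t\<in>F. \<bar>t (fst p) - t (snd p)\<bar> > \<epsilon>)"
      by (rule compactin_finite_nonvanishing)
    then obtain F \<epsilon> where F: "finite F" "F \<subseteq> T" "\<epsilon> > 0"
        "\<And>p. p \<in> A n \<Longrightarrow> \<exists>t\<in>F. \<bar>t (fst p) - t (snd p)\<bar> > \<epsilon>"
      by blast
    have "\<exists>t\<in>F. t (fst p) \<noteq> t (snd p)" if "p \<in> A n" for p
      using F(4)[OF that] F(3) by (metis abs_zero diff_self less_asym)
    with F(1,2) show ?thesis by blast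
  qed
  then obtain F where F: "\<And>n. finite (F n) \<and> F n \<subseteq> T \<and> (\<forall>p\<in>A n. \<exists>t\<in>F n. t (fst p) \<noteq> t (snd p))"
    by metis
  show ?thesis
  proof (intro exI[of _ "\<Union>n. F n"] conjI ballI impI)
    show "countable (\<Union>n. F n)" "(\<Union>n. F n) \<subseteq> T"
      using F by (auto intro: countable_finite)
    fix x y assume xy: "x \<in> topspace X" "y \<in> topspace X" "\<forall>t\<in>\<Union>n. F n. t x = t y"
    show "k x = k y"
    proof (rule ccontr)
      assume "k x \<noteq> k y"
      then obtain n where "1 / real (Suc n) < \<bar>k x - k y\<bar>"
        by (metis nat_approx_posE right_minus_eq zero_less_abs_iff)
      then have "(x,y) \<in> A n" using xy by (auto simp: A_def)
      then obtain t where "t \<in> F n" "t x \<noteq> t y" using F[of n] by fastforce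
      then show False using xy(3) by blast
    qed
  qed
qed

section \<open>Valdivia compactness in terms of coordinates\<close>

lemma valdivia_compactE:
  assumes "valdivia_compact X"
  obtains T where "coordinates X T" "\<And>t x. t \<in> T \<Longrightarrow> x \<in> topspace X \<Longrightarrow> t x \<in> {0..1}"
    "X closure_of {x \<in> topspace X. countable {t \<in> T. t x \<noteq> 0}} = topspace X"
proof -
  obtain T :: "('a \<Rightarrow> real) set" and h where V: "valdivia_embedding X T h"
    using assms by (auto simp: valdivia_compact_def)
  let ?D = "sigma_product T \<inter> h ` topspace X"
  have emb: "embedding_map X (cube T) h"
    and cl: "h ` topspace X = cube T closure_of ?D"
    using V by (auto simp: valdivia_embedding_def)
  have conth: "continuous_map X (cube T) h" and injh: "inj_on h (topspace X)"
    using emb by (auto simp: embedding_map_def homeomorphic_eq_everything_map continuous_map_in_subtopology)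
  have hT: "h x \<in> topspace (cube T)" if "x \<in> topspace X" for x
    using conth that continuous_map_image_subset_topspace by fastforce
  let ?F = "\<lambda>\<alpha> x. h x \<alpha>"
  show thesis
  proof (rule that[of "?F ` T"])
    show "coordinates X (?F ` T)"
      unfolding coordinates_def
    proof (intro conjI ballI impI)
      fix t assume "t \<in> ?F ` T"
      then obtain \<alpha> where \<alpha>: "\<alpha> \<in> T" "t = (\<lambda>x. h x \<alpha>)" by auto
      have "continuous_map (cube T) (top_of_set {0..1}) (\<lambda>z. z \<alpha>)"
        unfolding cube_def using \<alpha>(1) by (rule continuous_map_product_projection)
      then have "continuous_map (cube T) euclideanreal (\<lambda>z. z \<alpha>)"
        by (rule continuous_map_into_fulltopology)
      from continuous_map_compose[OF conth this] show "continuous_map X euclideanreal t"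
        by (simp add: \<alpha>(2) o_def)
    next
      fix x y assume "x \<in> topspace X" "y \<in> topspace X" "\<forall>t\<in>?F ` T. t x = t y"
      then have "h x = h y"
        using hT[of x] hT[of y] by (intro PiE_ext[of _ T "\<lambda>_. {0..1}"]) (auto simp: topspace_cube)
      then show "x = y" using injh \<open>x \<in> topspace X\<close> \<open>y \<in> topspace X\<close> by (auto simp: inj_on_def)
    qed
    show "t x \<in> {0..1}" if "t \<in> ?F ` T" "x \<in> topspace X" for t x
      using hT[OF that(2)] that(1) by (auto simp: topspace_cube)
    let ?E = "{x \<in> topspace X. countable {t \<in> ?F ` T. t x \<noteq> 0}}"
    have DE: "x \<in> ?E" if "x \<in> topspace X" "h x \<in> ?D" for x
    proof -
      \<comment> \<open>Different indices may induce the same function, so the new support is an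
        image of the old one and remains countable.\<close>
      have "{t \<in> ?F ` T. t x \<noteq> 0} = ?F ` {\<alpha> \<in> T. h x \<alpha> \<noteq> 0}" by auto
      with that show ?thesis by (auto simp: sigma_product_def)
    qed
    have "x \<in> X closure_of ?E" if x: "x \<in> topspace X" for x
      unfolding in_closure_of
    proof (intro conjI allI impI x)
      fix U assume U: "x \<in> U \<and> openin X U"
      have "open_map X (subtopology (cube T) (h ` topspace X)) h"
        using emb unfolding embedding_map_def homeomorphic_eq_everything_map by blast
      then have "openin (subtopology (cube T) (h ` topspace X)) (h ` U)"
        using U by (simp add: open_map_def)
      then obtain V where V: "openin (cube T) V" "h ` U = V \<inter> h ` topspace X"
        unfolding openin_subtopology by blast
      have "h x \<in> cube T closure_of ?D"
        by (subst cl[symmetric]) (use x in blast)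
      moreover have "h x \<in> V" using V U by blast
      ultimately obtain z where "z \<in> ?D" "z \<in> V"
        unfolding in_closure_of using V(1) by blast
      then have "z \<in> h ` U" using V(2) by blast
      then obtain x' where x': "x' \<in> U" "z = h x'" by blast
      moreover have "x' \<in> topspace X" using x'(1) U openin_subset by blast
      ultimately have "x' \<in> ?E" using \<open>z \<in> ?D\<close> by (intro DE) simp_all
      with x'(1) show "\<exists>y. y \<in> ?E \<and> y \<in> U" by blast
    qed
    then show "X closure_of ?E = topspace X"
      using closure_of_subset_topspace by fast
  qed
qed

text \<open>Evaluation at the members of \<open>T\<close> embeds the compact space in the cube. Its
  image is closed, hence contains the closure, and continuity carries the density of the countably
  supported points to the image.\<close>

lemma valdivia_compact_coordinatesI:
  assumes X: "compact_space X" "Hausdorff_space X" and T: "coordinates X T"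
    and range: "\<And>t x. t \<in> T \<Longrightarrow> x \<in> topspace X \<Longrightarrow> t x \<in> {0..1}"
    and dense: "X closure_of {x \<in> topspace X. countable {t \<in> T. t x \<noteq> 0}} = topspace X"
  shows "valdivia_compact X"
proof -
  define h where "h x = (\<lambda>t\<in>T. t x)" for x
  let ?D = "{x \<in> topspace X. countable {t \<in> T. t x \<noteq> 0}}"
  have cont: "continuous_map X (cube T) h"
    unfolding cube_def h_def using range
    by (auto simp: continuous_map_componentwise continuous_map_in_subtopology
        intro: coordinates_continuous[OF T])
  have inj: "inj_on h (topspace X)"
  proof (rule inj_onI)
    fix x y assume "x \<in> topspace X" "y \<in> topspace X" and eq: "h x = h y"
    moreover have "t x = t y" if "t \<in> T" for t
      using fun_cong[OF eq, of t] that by (simp add: h_def)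
    ultimately show "x = y" by (intro coordinates_eqI[OF T])
  qed
  have Haus: "Hausdorff_space (cube T)"
    by (auto simp: cube_def Hausdorff_space_product_topology intro!: Hausdorff_space_subtopology)
  have emb: "embedding_map X (cube T) h"
    using cont inj X Haus continuous_imp_closed_map injective_closed_imp_embedding_map by blast
  have D: "h ` ?D \<subseteq> sigma_product T \<inter> h ` topspace X"
  proof
    fix z assume "z \<in> h ` ?D"
    then obtain x where x: "x \<in> ?D" "z = h x" by auto
    have "{t \<in> T. h x t \<noteq> 0} = {t \<in> T. t x \<noteq> 0}" by (auto simp: h_def)
    moreover have "h x \<in> topspace (cube T)"
      using cont x(1) unfolding continuous_map_def by blast
    ultimately show "z \<in> sigma_product T \<inter> h ` topspace X"
      using x by (auto simp: sigma_product_def)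
  qed
  have "closedin (cube T) (h ` topspace X)"
    using X cont Haus by (metis compact_space_def compactin_imp_closedin image_compactin)
  then have "cube T closure_of (sigma_product T \<inter> h ` topspace X) \<subseteq> h ` topspace X"
    by (intro closure_of_minimal) auto
  moreover have "h ` topspace X \<subseteq> cube T closure_of (h ` ?D)"
    using continuous_map_image_closure_subset[OF cont, of ?D] dense by simp
  then have "h ` topspace X \<subseteq> cube T closure_of (sigma_product T \<inter> h ` topspace X)"
    using closure_of_mono[OF D, of "cube T"] by blast
  ultimately have "valdivia_embedding X T h"
    using emb by (auto simp: valdivia_embedding_def)
  then show ?thesis by (rule valdivia_compactI[OF X])
qed

section \<open>Transfinite sequences of one-step sections\<close>

lemma closedin_Collect_equalities:
  fixes \<phi> \<psi> :: "'i \<Rightarrow> 'a \<Rightarrow> real"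
  assumes "\<And>i. i \<in> A \<Longrightarrow> continuous_map X euclideanreal (\<phi> i)"
    and "\<And>i. i \<in> A \<Longrightarrow> continuous_map X euclideanreal (\<psi> i)"
  shows "closedin X {x \<in> topspace X. \<forall>i\<in>A. \<phi> i x = \<psi> i x}"
proof -
  have "closedin X {x \<in> topspace X. \<phi> i x - \<psi> i x = 0}" if "i \<in> A" for i
    using that by (intro closedin_eq_level continuous_map_diff assms)
  \<comment> \<open>Inserting \<open>topspace X\<close> gives the right intersection when
    \<open>A\<close> is empty.\<close>
  then have "closedin X (\<Inter> (insert (topspace X) ((\<lambda>i. {x \<in> topspace X. \<phi> i x - \<psi> i x = 0}) ` A)))"
    by (intro closedin_Inter) auto
  also have "\<Inter> (insert (topspace X) ((\<lambda>i. {x \<in> topspace X. \<phi> i x - \<psi> i x = 0}) ` A)) =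
      {x \<in> topspace X. \<forall>i\<in>A. \<phi> i x = \<psi> i x}"
    by auto
  finally show ?thesis .
qed

text \<open>
  Write \<open>Y\<^sub>a\<close> for the quotient of \<open>Y\<close> determined by the functions in \<open>N\<^sub>0\<close> and in \<open>N b\<close> for \<open>b < a\<close>.
  Adjoining \<open>N a\<close> gives the next quotient, and \<open>P a\<close> represents a continuous section of it over \<open>Y\<^sub>a\<close>
  by points of \<open>Y\<close>; as a map from \<open>Y\<close> to itself it need not be continuous.
\<close>

locale retractive_sequence =
  fixes Y :: "'b topology" and r :: "'i rel"
    and N\<^sub>0 :: "('b \<Rightarrow> real) set" and N :: "'i \<Rightarrow> ('b \<Rightarrow> real) set" and P :: "'i \<Rightarrow> 'b \<Rightarrow> 'b"
  assumes compact: "compact_space Y" and wo: "Well_order r"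
    and coords: "coordinates Y (N\<^sub>0 \<union> \<Union> (N ` Field r))"
    and P_in: "\<And>a y. a \<in> Field r \<Longrightarrow> y \<in> topspace Y \<Longrightarrow> P a y \<in> topspace Y"
    and P_lift: "\<And>a y e. a \<in> Field r \<Longrightarrow> y \<in> topspace Y \<Longrightarrow>
      e \<in> N\<^sub>0 \<union> \<Union> (N ` underS r a) \<Longrightarrow> e (P a y) = e y"
    and P_factors: "\<And>a y y' e. a \<in> Field r \<Longrightarrow> y \<in> topspace Y \<Longrightarrow> y' \<in> topspace Y \<Longrightarrow>
      (\<And>d. d \<in> N\<^sub>0 \<union> \<Union> (N ` underS r a) \<Longrightarrow> d y = d y') \<Longrightarrow> e \<in> N a \<Longrightarrow> e (P a y) = e (P a y')"
    and P_cont: "\<And>a e. a \<in> Field r \<Longrightarrow> e \<in> N a \<Longrightarrow> continuous_map Y euclideanreal (\<lambda>y. e (P a y))"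
begin

lemma N_cont: "a \<in> Field r \<Longrightarrow> e \<in> N a \<Longrightarrow> continuous_map Y euclideanreal e"
  by (rule coordinates_continuous[OF coords]) auto

lemma N0_cont: "e \<in> N\<^sub>0 \<Longrightarrow> continuous_map Y euclideanreal e"
  by (rule coordinates_continuous[OF coords]) auto

lemma r_total: "a \<in> Field r \<Longrightarrow> b \<in> Field r \<Longrightarrow> (a,b) \<in> r \<or> (b,a) \<in> r"
  using wo wo_rel.TOTALS[unfolded wo_rel_def] by blast

lemma r_trans: "(a,b) \<in> r \<Longrightarrow> (b,c) \<in> r \<Longrightarrow> (a,c) \<in> r"
  using wo by (meson order_on_defs(1,2,3) transD well_order_on_def)

lemma r_refl: "a \<in> Field r \<Longrightarrow> (a,a) \<in> r"
  using wo wo_rel.REFL[unfolded wo_rel_def] by (auto simp: refl_on_def)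

lemma r_antisym: "(a,b) \<in> r \<Longrightarrow> (b,a) \<in> r \<Longrightarrow> a = b"
  using wo wo_rel.ANTISYM[unfolded wo_rel_def] by (auto simp: antisym_def)

lemma r_induct [consumes 1, case_names less]:
  assumes "a \<in> Field r"
    and "\<And>a. a \<in> Field r \<Longrightarrow> (\<And>b. b \<in> underS r a \<Longrightarrow> b \<in> Field r \<Longrightarrow> Q b) \<Longrightarrow> Q a"
  shows "Q a"
proof -
  have "wf (r - Id)" using wo by (simp add: well_order_on_def)
  then have "a \<in> Field r \<longrightarrow> Q a"
  proof (induction a rule: wf_induct_rule)
    case (less a)
    then show ?case
      using assms(2)[of a] by (auto simp: underS_def FieldI1)
  qed
  with assms(1) show ?thesis by simp
qed

text \<open>
  Such a point \<open>z\<close> is obtained from \<open>y\<close> by following the sections along all steps outside \<open>J\<close>: at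
  a step \<open>b\<close> the point is replaced by its image under \<open>P b\<close>, at limits one uses compactness.
\<close>

lemma exists_stable_point:
  assumes J: "J \<subseteq> Field r" "\<forall>b\<in>J. \<forall>c. (c,b) \<in> r \<longrightarrow> c \<in> J"
    and y: "y \<in> topspace Y"
  shows "\<exists>z\<in>topspace Y. (\<forall>c\<in>Field r - J. \<forall>e\<in>N c. e z = e (P c z)) \<and>
    (\<forall>e\<in>N\<^sub>0 \<union> \<Union> (N ` J). e z = e y)"
proof -
  \<comment> \<open>\<open>B\<close> pins the functions already committed to their values at
    \<open>y\<close>. \<open>S b\<close> demands stability at all steps outside \<open>J\<close> up
    to and including \<open>b\<close>.\<close>
  define B where "B = {z \<in> topspace Y. \<forall>e\<in>N\<^sub>0 \<union> \<Union> (N ` J). e z = e y}"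
  define S where "S b = {z \<in> topspace Y. \<forall>p\<in>Sigma {c \<in> Field r - J. (c,b) \<in> r} N. snd p z = snd p (P (fst p) z)}" for b
  define C where "C b = B \<inter> S b" for b
  have "closedin Y B"
    unfolding B_def using J(1) by (intro closedin_Collect_equalities) (auto intro: N_cont N0_cont)
  moreover have "closedin Y (S b)" for b
    unfolding S_def by (intro closedin_Collect_equalities) (auto intro: N_cont P_cont)
  ultimately have closed: "closedin Y B" "closedin Y (C b)" for b
    by (auto simp: C_def)
  have mono: "C b \<subseteq> C c" if "(c,b) \<in> r" for b c
  proof -
    have "Sigma {d \<in> Field r - J. (d,c) \<in> r} N \<subseteq> Sigma {d \<in> Field r - J. (d,b) \<in> r} N"
      using that r_trans by blast
    then show ?thesis unfolding C_def S_def by blast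
  qed
  \<comment> \<open>Adjoining \<open>B\<close> covers the case of empty \<open>K\<close>. The
    remaining sets form a chain because \<open>r\<close> is total and \<open>C\<close> is
    decreasing.\<close>
  have inter: "\<Inter> (insert B (C ` K)) \<noteq> {}"
    if K: "K \<subseteq> Field r" and ne: "\<And>b. b \<in> K \<Longrightarrow> C b \<noteq> {}" for K
  proof (rule compact_space_directed_Inter[OF compact])
    have "y \<in> B" using y by (simp add: B_def)
    then show "D \<noteq> {}" if "D \<in> insert B (C ` K)" for D using that ne by auto
    show "closedin Y D" if "D \<in> insert B (C ` K)" for D using that closed by auto
    fix D D' assume D: "D \<in> insert B (C ` K)" "D' \<in> insert B (C ` K)"
    have CB: "C b \<subseteq> B" for b by (simp add: C_def)
    show "\<exists>D''\<in>insert B (C ` K). D'' \<subseteq> D \<inter> D'"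
    proof (cases "D = B \<or> D' = B")
      case True
      moreover have "D \<subseteq> B" "D' \<subseteq> B" using D CB by auto
      ultimately have "D' \<subseteq> D \<inter> D' \<or> D \<subseteq> D \<inter> D'" by blast
      then show ?thesis using D by blast
    next
      case False
      then obtain b b' where b: "b \<in> K" "b' \<in> K" "D = C b" "D' = C b'" using D by auto
      then have "(b,b') \<in> r \<or> (b',b) \<in> r" using K r_total by blast
      then have "C b \<subseteq> C b' \<or> C b' \<subseteq> C b" using mono by blast
      then show ?thesis using b by blast
    qed
  qed auto
  have ne: "b \<notin> J \<longrightarrow> C b \<noteq> {}" if "b \<in> Field r" for b
    using that
  proof (induction b rule: r_induct)
    case (less b)
    show ?case
    proof
      assume bJ: "b \<notin> J"
      \<comment> \<open>Compactness treats successor and limit steps alike: it yields a point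
        \<open>z\<close> stable at every earlier step outside \<open>J\<close>, and
        \<open>P b z\<close> is the witness for step \<open>b\<close>.\<close>
      have "\<Inter> (insert B (C ` (underS r b - J))) \<noteq> {}"
        using less by (intro inter) (auto dest: underS_Field)
      then obtain z where z: "z \<in> B" "\<And>c. c \<in> underS r b - J \<Longrightarrow> z \<in> C c" by blast
      have zY: "z \<in> topspace Y" using z(1) by (simp add: B_def)
      have Pz: "P b z \<in> topspace Y" using less(1) zY by (rule P_in)
      have JS: "J \<subseteq> underS r b"
        using J bJ less(1) r_total[of b] by (fastforce simp: underS_def)
      have "e (P b z) = e y" if "e \<in> N\<^sub>0 \<union> \<Union> (N ` J)" for e
      proof -
        have "e (P b z) = e z"
          using that JS by (intro P_lift[OF less(1) zY]) blast
        also have "\<dots> = e y"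
          using z(1) that unfolding B_def by blast
        finally show ?thesis .
      qed
      then have "P b z \<in> B"
        using Pz by (auto simp: B_def)
      moreover have "P b z \<in> S b"
        unfolding S_def
      proof (intro CollectI conjI ballI Pz)
        fix p assume "p \<in> Sigma {c \<in> Field r - J. (c,b) \<in> r} N"
        then obtain c e where p: "p = (c,e)" "c \<in> Field r" "c \<notin> J" "(c,b) \<in> r" "e \<in> N c" by auto
        have sub: "underS r c \<subseteq> underS r b"
          using p(4) r_trans r_antisym by (fastforce simp: underS_def)
        \<comment> \<open>\<open>P b z\<close> and \<open>z\<close> agree on every function
          appearing before \<open>b\<close>, hence before \<open>c\<close>, and \<open>P c\<close>
          depends on no others. For \<open>c = b\<close> this is already stability of
          \<open>P b z\<close> at \<open>b\<close>.\<close>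
        have eq: "e (P c (P b z)) = e (P c z)"
          using P_lift[OF less(1) zY] sub by (intro P_factors[OF p(2) Pz zY _ p(5)]) blast
        show "snd p (P b z) = snd p (P (fst p) (P b z))"
        proof (cases "c = b")
          case True
          then show ?thesis using eq p(1) by simp
        next
          case False
          then have c: "c \<in> underS r b" using p(4) by (simp add: underS_def)
          then have "z \<in> S c" using z(2) p(3) by (auto simp: C_def)
          then have "e z = e (P c z)"
            using p r_refl by (force simp: S_def)
          moreover have "e (P b z) = e z"
            using c p(5) by (intro P_lift[OF less(1) zY]) blast
          ultimately show ?thesis using eq p(1) by simp
        qed
      qed
      ultimately show "C b \<noteq> {}" by (auto simp: C_def)
    qed
  qed
  have "\<Inter> (insert B (C ` (Field r - J))) \<noteq> {}"
    using ne by (intro inter) auto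
  then obtain z where z: "z \<in> B" "\<And>c. c \<in> Field r - J \<Longrightarrow> z \<in> C c" by blast
  show ?thesis
  proof (intro bexI[of _ z] conjI ballI)
    show "z \<in> topspace Y" using z(1) by (simp add: B_def)
    show "e z = e y" if "e \<in> N\<^sub>0 \<union> \<Union> (N ` J)" for e
      using z(1) that by (simp add: B_def)
    show "e z = e (P c z)" if "c \<in> Field r - J" "e \<in> N c" for c e
    proof -
      have "z \<in> S c" using z(2)[OF that(1)] by (simp add: C_def)
      moreover have "(c,e) \<in> Sigma {c' \<in> Field r - J. (c',c) \<in> r} N"
        using that r_refl by auto
      ultimately show ?thesis unfolding S_def by force
    qed
  qed
qed

text \<open>A basic neighbourhood involves finitely many functions, which appear at steps inside a
  countable initial segment \<open>J\<close>. A point stable outside \<open>J\<close> can be found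
  in it, and there every new coordinate belonging to a step outside \<open>J\<close>
  vanishes.\<close>

lemma valdivia_compact:
  assumes "Hausdorff_space Y"
    and cN0: "countable N\<^sub>0" and cN: "\<And>a. a \<in> Field r \<Longrightarrow> countable (N a)"
    and cr: "\<And>a. a \<in> Field r \<Longrightarrow> countable (underS r a)"
    and range: "\<And>e y. e \<in> N\<^sub>0 \<union> \<Union> (N ` Field r) \<Longrightarrow> y \<in> topspace Y \<Longrightarrow> e y \<in> {0..1}"
  shows "valdivia_compact Y"
proof -
  \<comment> \<open>The difference \<open>e y - e (P a y)\<close> lies between -1 and 1. Its two
    parts take values in the unit interval and together determine it.\<close>
  define pos where "pos a e = (\<lambda>y. max 0 (e y - e (P a y)))" for a and e :: "'b \<Rightarrow> real"
  define neg where "neg a e = (\<lambda>y. max 0 (e (P a y) - e y))" for a and e :: "'b \<Rightarrow> real"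
  define V where "V a = (\<Union>e\<in>N a. {pos a e, neg a e})" for a
  define U where "U = N\<^sub>0 \<union> \<Union> (V ` Field r)"
  show ?thesis
  proof (rule valdivia_compact_coordinatesI[OF compact assms(1)])
    show "coordinates Y U"
      unfolding coordinates_def
    proof (intro conjI ballI impI)
      fix u assume "u \<in> U"
      then consider "u \<in> N\<^sub>0" | a e where "a \<in> Field r" "e \<in> N a" "u = pos a e \<or> u = neg a e"
        by (auto simp: U_def V_def)
      then show "continuous_map Y euclideanreal u"
      proof cases
        case 1
        then show ?thesis by (rule N0_cont)
      next
        case 2
        have "continuous_map Y euclideanreal (pos a e)" "continuous_map Y euclideanreal (neg a e)"
          unfolding pos_def neg_def
          by (intro continuous_map_real_max continuous_map_diff N_cont[OF 2(1,2)] P_cont[OF 2(1,2)]; simp)+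
        then show ?thesis using 2(3) by auto
      qed
    next
      fix y y' assume y: "y \<in> topspace Y" "y' \<in> topspace Y" and eq: "\<forall>u\<in>U. u y = u y'"
      \<comment> \<open>Once all earlier functions agree at \<open>y\<close> and \<open>y'\<close>,
        \<open>P_factors\<close> makes \<open>e (P a y)\<close> and \<open>e (P a y')\<close> equal,
        and the two parts of the difference then recover \<open>e\<close>.\<close>
      have "\<forall>e\<in>N a. e y = e y'" if "a \<in> Field r" for a
        using that
      proof (induction a rule: r_induct)
        case (less a)
        show ?case
        proof
          fix e assume e: "e \<in> N a"
          have "d y = d y'" if "d \<in> N\<^sub>0 \<union> \<Union> (N ` underS r a)" for d
            using that eq less(2) by (auto simp: U_def dest: underS_Field)
          then have "e (P a y) = e (P a y')"
            by (rule P_factors[OF less(1) y _ e])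
          moreover have "pos a e \<in> U" "neg a e \<in> U"
            using less(1) e by (auto simp: U_def V_def)
          then have "pos a e y = pos a e y'" "neg a e y = neg a e y'"
            using eq by auto
          ultimately show "e y = e y'"
            by (auto simp: pos_def neg_def max_def split: if_splits)
        qed
      qed
      then show "y = y'"
        using eq by (intro coordinates_eqI[OF coords y]) (auto simp: U_def)
    qed
    show "u y \<in> {0..1}" if "u \<in> U" "y \<in> topspace Y" for u y
    proof (cases "u \<in> N\<^sub>0")
      case True
      then show ?thesis using range that(2) by blast
    next
      case False
      then obtain a e where a: "a \<in> Field r" "e \<in> N a" "u = pos a e \<or> u = neg a e"
        using \<open>u \<in> U\<close> by (auto simp: U_def V_def)
      have "e y \<in> {0..1}" "e (P a y) \<in> {0..1}"
        using a that(2) P_in by (auto intro!: range simp del: atLeastAtMost_iff)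
      then show ?thesis using a(3) by (auto simp: pos_def neg_def)
    qed
    let ?D = "{y \<in> topspace Y. countable {u \<in> U. u y \<noteq> 0}}"
    have "y \<in> Y closure_of ?D" if y: "y \<in> topspace Y" for y
      unfolding in_closure_of
    proof (intro conjI allI impI y)
      fix G assume G: "y \<in> G \<and> openin Y G"
      then obtain F \<epsilon> where F: "finite F" "F \<subseteq> N\<^sub>0 \<union> \<Union> (N ` Field r)" "\<epsilon> > 0"
        "\<And>z. z \<in> topspace Y \<Longrightarrow> (\<And>t. t \<in> F \<Longrightarrow> \<bar>t z - t y\<bar> \<le> \<epsilon>) \<Longrightarrow> z \<in> G"
        using coordinates_neighbourhood[OF compact coords, of G y] by metis
      have "\<forall>e\<in>F - N\<^sub>0. \<exists>b. b \<in> Field r \<and> e \<in> N b" using F(2) by auto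
      then obtain b where b: "\<And>e. e \<in> F - N\<^sub>0 \<Longrightarrow> b e \<in> Field r \<and> e \<in> N (b e)" by metis
      \<comment> \<open>\<open>J\<close> is the initial segment generated by the steps chosen for
        the functions in \<open>F\<close>. Those in \<open>N\<^sub>0\<close> are matched by the
        stable point in any case.\<close>
      define J where "J = (\<Union>e\<in>F - N\<^sub>0. insert (b e) (underS r (b e)))"
      have JF: "J \<subseteq> Field r" using b underS_Field by (fastforce simp: J_def)
      have Jdown: "\<forall>d\<in>J. \<forall>c. (c,d) \<in> r \<longrightarrow> c \<in> J"
        using r_trans r_antisym unfolding J_def underS_def by blast
      obtain z where z: "z \<in> topspace Y" "\<And>c e. c \<in> Field r - J \<Longrightarrow> e \<in> N c \<Longrightarrow> e z = e (P c z)"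
          "\<And>e. e \<in> N\<^sub>0 \<union> \<Union> (N ` J) \<Longrightarrow> e z = e y"
        using exists_stable_point[OF JF Jdown y] by blast
      have "z \<in> G"
      proof (rule F(4)[OF z(1)])
        fix t assume "t \<in> F"
        then have "t \<in> N\<^sub>0 \<union> \<Union> (N ` J)" using b by (auto simp: J_def)
        then have "t z = t y" by (rule z(3))
        then show "\<bar>t z - t y\<bar> \<le> \<epsilon>" using F(3) by simp
      qed
      moreover have "countable {u \<in> U. u z \<noteq> 0}"
      proof (rule countable_subset)
        show "{u \<in> U. u z \<noteq> 0} \<subseteq> N\<^sub>0 \<union> \<Union> (V ` J)"
        proof
          fix u assume u: "u \<in> {u \<in> U. u z \<noteq> 0}"
          show "u \<in> N\<^sub>0 \<union> \<Union> (V ` J)"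
          proof (cases "u \<in> N\<^sub>0")
            case False
            then obtain a e where a: "a \<in> Field r" "e \<in> N a" "u = pos a e \<or> u = neg a e"
              using u by (auto simp: U_def V_def)
            have "e z \<noteq> e (P a z)" using a(3) u by (auto simp: pos_def neg_def)
            with a(1,2) z(2) have "a \<in> J" by blast
            then show ?thesis using a by (auto simp: V_def)
          qed auto
        qed
        have "countable J"
          unfolding J_def using F(1) b cr by (intro countable_UN) (auto intro: countable_finite)
        then show "countable (N\<^sub>0 \<union> \<Union> (V ` J))"
          unfolding V_def using cN0 cN JF by (intro countable_Un countable_UN) auto
      qed
      ultimately show "\<exists>z. z \<in> ?D \<and> z \<in> G" using z(1) by blast
    qed
    then show "Y closure_of ?D = topspace Y"
      using closure_of_subset_topspace by fast
  qed
qed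

end

section \<open>Zero-dimensional selection\<close>

lemma coordinates_imp_Hausdorff_space:
  assumes "coordinates X T"
  shows "Hausdorff_space X"
  unfolding Hausdorff_space_def
proof (intro allI impI)
  fix x y assume xy: "x \<in> topspace X \<and> y \<in> topspace X \<and> x \<noteq> y"
  then obtain t where t: "t \<in> T" "t x \<noteq> t y"
    using assms unfolding coordinates_def by blast
  obtain A B where AB: "open A" "open B" "t x \<in> A" "t y \<in> B" "A \<inter> B = {}"
    using hausdorff[OF t(2)] by metis
  let ?pre = "\<lambda>A. {z \<in> topspace X. t z \<in> A}"
  have "openin X (?pre A)" "openin X (?pre B)"
    using AB coordinates_continuous[OF assms t(1)]
    by (auto intro!: openin_continuous_map_preimage[where Y=euclideanreal])
  then show "\<exists>U V. openin X U \<and> openin X V \<and> x \<in> U \<and> y \<in> V \<and> disjnt U V"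
    using AB xy by (intro exI[of _ "?pre A"] exI[of _ "?pre B"]) (auto simp: disjnt_def)
qed

text \<open>For functions with values 0 and 1, \<open>t y = t x\<close> amounts to the open
  condition that the values differ by less than 1. Finite intersections of such clopen sets form
  neighbourhood bases.\<close>

lemma coordinates_01_imp_dim_le_0:
  assumes "compact_space X" "coordinates X T"
    and T: "\<forall>t\<in>T. \<forall>x\<in>topspace X. t x \<in> {0,1}"
  shows "X dim_le 0"
  unfolding dimension_le_0_neighbourhood_base_of_clopen neighbourhood_base_of
proof (intro allI impI)
  fix W x assume W: "openin X W \<and> x \<in> W"
  then have x: "x \<in> topspace X" using openin_subset by blast
  obtain F \<epsilon> where F: "finite F" "F \<subseteq> T" "\<epsilon> > 0"
    "\<And>y. y \<in> topspace X \<Longrightarrow> (\<And>t. t \<in> F \<Longrightarrow> \<bar>t y - t x\<bar> \<le> \<epsilon>) \<Longrightarrow> y \<in> W"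
    using coordinates_neighbourhood[OF assms(1,2), of W x] W by metis
  define Q where "Q = topspace X \<inter> \<Inter> ((\<lambda>t. {y \<in> topspace X. t y = t x}) ` F)"
  have clopen: "closedin X {y \<in> topspace X. t y = t x}" "openin X {y \<in> topspace X. t y = t x}"
    if "t \<in> F" for t
  proof -
    have cont: "continuous_map X euclideanreal t"
      using that F(2) coordinates_continuous[OF assms(2)] by blast
    show "closedin X {y \<in> topspace X. t y = t x}" using cont by (rule closedin_eq_level)
    have "t y = t x \<longleftrightarrow> \<bar>t y - t x\<bar> < 1" if "y \<in> topspace X" for y
    proof -
      have "t y \<in> {0,1}" "t x \<in> {0,1}" using T x that \<open>t \<in> F\<close> F(2) by blast+
      then show ?thesis by auto
    qed
    then have "{y \<in> topspace X. t y = t x} = {y \<in> topspace X. \<bar>t y - t x\<bar> < 1}"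
      by blast
    then show "openin X {y \<in> topspace X. t y = t x}"
      using cont by (auto intro!: openin_less_level continuous_map_real_abs continuous_map_diff)
  qed
  have "openin X Q"
    unfolding Q_def using clopen(2) F(1) by (intro openin_Int_Inter) auto
  moreover have "closedin X (\<Inter> (insert (topspace X) ((\<lambda>t. {y \<in> topspace X. t y = t x}) ` F)))"
    using clopen(1) by (intro closedin_Inter) auto
  then have "closedin X Q" by (simp add: Q_def)
  moreover have "x \<in> Q" using x by (simp add: Q_def)
  moreover have "Q \<subseteq> W"
  proof
    fix y assume y: "y \<in> Q"
    show "y \<in> W"
    proof (rule F(4))
      show "y \<in> topspace X" using y by (simp add: Q_def)
      fix t assume "t \<in> F"
      then have "t y = t x" using y by (simp add: Q_def)
      then show "\<bar>t y - t x\<bar> \<le> \<epsilon>" using F(3) by simp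
    qed
  qed
  ultimately show "\<exists>U V. openin X U \<and> (closedin X V \<and> openin X V) \<and> x \<in> U \<and> U \<subseteq> V \<and> V \<subseteq> W"
    by blast
qed

lemma dim_le_0_clopen_point:
  assumes "X dim_le 0" "openin X W" "x \<in> W"
  obtains Q where "openin X Q" "closedin X Q" "x \<in> Q" "Q \<subseteq> W"
proof -
  have "\<exists>U V. openin X U \<and> (closedin X V \<and> openin X V) \<and> x \<in> U \<and> U \<subseteq> V \<and> V \<subseteq> W"
    using assms(1)[unfolded dimension_le_0_neighbourhood_base_of_clopen neighbourhood_base_of] assms(2,3)
    by simp
  then obtain U V where "closedin X V" "openin X V" "x \<in> U" "U \<subseteq> V" "V \<subseteq> W"
    by blast
  then show thesis by (intro that[of V]) auto
qed

text \<open>Clopen subsets of \<open>W\<close> cover \<open>A\<close>, and a finite union of clopen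
  sets is clopen.\<close>

lemma dim_le_0_clopen_between:
  assumes "X dim_le 0" "compactin X A" "openin X W" "A \<subseteq> W"
  obtains Q where "openin X Q" "closedin X Q" "A \<subseteq> Q" "Q \<subseteq> W"
proof -
  define \<Q> where "\<Q> = {Q. openin X Q \<and> closedin X Q \<and> Q \<subseteq> W}"
  have "A \<subseteq> \<Union>\<Q>"
  proof
    fix x assume "x \<in> A"
    then obtain Q where "openin X Q" "closedin X Q" "x \<in> Q" "Q \<subseteq> W"
      using dim_le_0_clopen_point[OF assms(1,3), of x] assms(4) by (metis subsetD)
    then show "x \<in> \<Union>\<Q>" unfolding \<Q>_def by blast
  qed
  moreover have "\<forall>Q\<in>\<Q>. openin X Q" by (simp add: \<Q>_def)
  ultimately obtain \<F> where \<F>: "finite \<F>" "\<F> \<subseteq> \<Q>" "A \<subseteq> \<Union>\<F>"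
    using assms(2) unfolding compactin_def by blast
  show thesis
  proof (rule that[of "\<Union>\<F>"])
    show "openin X (\<Union>\<F>)" using \<F>(2) by (auto simp: \<Q>_def)
    show "closedin X (\<Union>\<F>)" using \<F>(1,2) by (auto simp: \<Q>_def intro!: closedin_Union)
  qed (use \<F> in \<open>auto simp: \<Q>_def\<close>)
qed

text \<open>One step towards a selection: the domain shrinks so that \<open>u\<close> varies by less
  than \<open>\<epsilon>\<close> on each fibre while \<open>F\<close> stays onto. Small pieces exist
  locally because \<open>F\<close> is open; a finite clopen cover of \<open>C\<close>, made
  disjoint, glues them.\<close>

lemma shrink_selection_domain:
  fixes u :: "'a \<Rightarrow> real"
  assumes K: "compact_space K" "Hausdorff_space K" and C: "compact_space C" "C dim_le 0"
    and F: "continuous_map K C F" "open_map K C F"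
    and W: "openin K W" "F ` W = topspace C"
    and u: "continuous_map K euclideanreal u" and \<epsilon>: "\<epsilon> > 0"
  shows "\<exists>W'. openin K W' \<and> F ` W' = topspace C \<and> K closure_of W' \<subseteq> W \<and>
    (\<forall>x\<in>W'. \<forall>x'\<in>W'. F x = F x' \<longrightarrow> \<bar>u x - u x'\<bar> < \<epsilon>)"
proof -
  have "\<exists>U V Q. openin K U \<and> closedin K V \<and> U \<subseteq> V \<and> V \<subseteq> W \<and>
      openin C Q \<and> closedin C Q \<and> c \<in> Q \<and> Q \<subseteq> F ` U \<and> (\<forall>x\<in>U. \<forall>x'\<in>U. \<bar>u x - u x'\<bar> < \<epsilon>)"
    if c: "c \<in> topspace C" for c
  proof -
    have "c \<in> F ` W" using W(2) c by simp
    then obtain x where x: "x \<in> W" "F x = c" by blast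
    have xK: "x \<in> topspace K" using x(1) W(1) openin_subset by blast
    define G where "G = W \<inter> {y \<in> topspace K. \<bar>u y - u x\<bar> < \<epsilon> / 2}"
    have "openin K G"
      unfolding G_def using u
      by (intro openin_Int W(1) openin_less_level continuous_map_real_abs continuous_map_diff) auto
    moreover have "x \<in> G" using x(1) xK \<epsilon> by (simp add: G_def)
    ultimately obtain U V where UV: "openin K U" "closedin K V" "x \<in> U" "U \<subseteq> V" "V \<subseteq> G"
      using compact_Hausdorff_imp_regular_space[OF K]
      unfolding neighbourhood_base_of_closedin[symmetric] neighbourhood_base_of by metis
    have "openin C (F ` U)" using F(2) UV(1) by (simp add: open_map_def)
    then obtain Q where Q: "openin C Q" "closedin C Q" "c \<in> Q" "Q \<subseteq> F ` U"
      using dim_le_0_clopen_point[OF C(2), of "F ` U" c] UV(3) x(2) by blast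
    have "\<bar>u y - u y'\<bar> < \<epsilon>" if "y \<in> U" "y' \<in> U" for y y'
    proof -
      have "\<bar>u y - u x\<bar> < \<epsilon> / 2" "\<bar>u y' - u x\<bar> < \<epsilon> / 2" using that UV by (auto simp: G_def)
      then show ?thesis by linarith
    qed
    moreover have "V \<subseteq> W" using UV(5) by (auto simp: G_def)
    ultimately show ?thesis using UV Q by blast
  qed
  then obtain U V Q where UVQ: "\<And>c. c \<in> topspace C \<Longrightarrow> openin K (U c) \<and> closedin K (V c) \<and>
      U c \<subseteq> V c \<and> V c \<subseteq> W \<and> openin C (Q c) \<and> closedin C (Q c) \<and> c \<in> Q c \<and> Q c \<subseteq> F ` U c \<and>
      (\<forall>x\<in>U c. \<forall>x'\<in>U c. \<bar>u x - u x'\<bar> < \<epsilon>)"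
    by metis
  \<comment> \<open>The closed set \<open>V'\<close> between \<open>W'\<close> and \<open>W\<close>
    is carried along to control the closure of \<open>W'\<close> at the end.\<close>
  have step: "\<exists>W' V'. openin K W' \<and> closedin K V' \<and> W' \<subseteq> V' \<and> V' \<subseteq> W \<and> F ` W' = \<Union> (Q ` G) \<and>
      (\<forall>x\<in>W'. \<forall>x'\<in>W'. F x = F x' \<longrightarrow> \<bar>u x - u x'\<bar> < \<epsilon>)"
    if "finite G" "G \<subseteq> topspace C" for G
    using that
  proof (induction G)
    case empty
    then show ?case by (intro exI[of _ "{}"]) auto
  next
    case (insert c G)
    then obtain W' V' where W': "openin K W'" "closedin K V'" "W' \<subseteq> V'" "V' \<subseteq> W" "F ` W' = \<Union> (Q ` G)"
        "\<forall>x\<in>W'. \<forall>x'\<in>W'. F x = F x' \<longrightarrow> \<bar>u x - u x'\<bar> < \<epsilon>"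
      by auto
    have c: "c \<in> topspace C" using insert.prems by simp
    note c' = UVQ[OF c]
    \<comment> \<open>Only the part of \<open>Q c\<close> not yet covered receives the new piece, so
      no fibre meets two pieces and the oscillation bound survives.\<close>
    define R where "R = Q c - \<Union> (Q ` G)"
    define U' where "U' = U c \<inter> {x \<in> topspace K. F x \<in> R}"
    have "closedin C (\<Union> (Q ` G))"
      using insert.hyps insert.prems UVQ by (intro closedin_Union) auto
    then have "openin C R" using c' by (auto simp: R_def)
    then have "openin K U'"
      unfolding U'_def using c' F(1) by (auto intro: openin_continuous_map_preimage)
    moreover have "F ` U' = R"
    proof
      show "R \<subseteq> F ` U'"
      proof
        fix d assume d: "d \<in> R"
        then obtain x where "x \<in> U c" "F x = d" using c' by (auto simp: R_def)
        moreover have "x \<in> topspace K" using \<open>x \<in> U c\<close> c' openin_subset by blast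
        ultimately show "d \<in> F ` U'" using d by (auto simp: U'_def)
      qed
    qed (auto simp: U'_def)
    ultimately have "openin K (W' \<union> U')" "F ` (W' \<union> U') = \<Union> (Q ` insert c G)"
      using W' by (auto simp: R_def image_Un)
    moreover have "\<bar>u x - u x'\<bar> < \<epsilon>" if x: "x \<in> W' \<union> U'" "x' \<in> W' \<union> U'" "F x = F x'" for x x'
    proof -
      have "F x \<in> \<Union> (Q ` G)" if "x \<in> W'" for x using W'(5) that by blast
      moreover have "F x \<notin> \<Union> (Q ` G)" if "x \<in> U'" for x using that by (auto simp: U'_def R_def)
      ultimately consider "x \<in> W'" "x' \<in> W'" | "x \<in> U'" "x' \<in> U'"
        using x by (metis Un_iff)
      then show ?thesis
        using W'(6) x(3) c' by cases (auto simp: U'_def)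
    qed
    moreover have "W' \<union> U' \<subseteq> V' \<union> V c" "V' \<union> V c \<subseteq> W"
      using W' c' by (auto simp: U'_def)
    moreover have "closedin K (V' \<union> V c)" using W' c' by auto
    ultimately show ?case by blast
  qed
  have "compactin C (topspace C)" using C(1) by (simp add: compact_space_def)
  moreover have "\<forall>D\<in>Q ` topspace C. openin C D" "topspace C \<subseteq> \<Union> (Q ` topspace C)"
    using UVQ by auto
  ultimately obtain \<F> where "finite \<F>" "\<F> \<subseteq> Q ` topspace C" "topspace C \<subseteq> \<Union>\<F>"
    unfolding compactin_def by meson
  then obtain G where G: "finite G" "G \<subseteq> topspace C" "topspace C \<subseteq> \<Union> (Q ` G)"
    by (metis finite_subset_image)
  obtain W' V' where W': "openin K W'" "closedin K V'" "W' \<subseteq> V'" "V' \<subseteq> W" "F ` W' = \<Union> (Q ` G)"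
      "\<forall>x\<in>W'. \<forall>x'\<in>W'. F x = F x' \<longrightarrow> \<bar>u x - u x'\<bar> < \<epsilon>"
    using step[OF G(1,2)] by blast
  have "Q c \<subseteq> topspace C" if "c \<in> G" for c
    using UVQ[of c] that G(2) openin_subset by blast
  then have "F ` W' = topspace C" unfolding W'(5) using G(3) by blast
  moreover have "K closure_of W' \<subseteq> W" using W'(2-4) closure_of_minimal by (metis subset_trans)
  ultimately show ?thesis using W'(1,6) by blast
qed

text \<open>Repeated shrinking leaves a closed set \<open>L\<close> that meets each fibre in exactly
  one point. The inverse of \<open>F\<close> on \<open>L\<close> is continuous because
  \<open>F\<close> is a closed map.\<close>

lemma dim_le_0_continuous_selection:
  assumes K: "compact_space K" and C: "compact_space C" "Hausdorff_space C" "C dim_le 0"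
    and F: "continuous_map K C F" "open_map K C F" "F ` topspace K = topspace C"
    and S: "coordinates K S" "countable S"
  obtains g where "continuous_map C K g" "\<And>c. c \<in> topspace C \<Longrightarrow> F (g c) = c"
proof -
  have KH: "Hausdorff_space K" using S(1) by (rule coordinates_imp_Hausdorff_space)
  \<comment> \<open>The zero function makes the family nonempty, so that it can be enumerated even
    if \<open>S\<close> is empty.\<close>
  define u where "u = from_nat_into (insert (\<lambda>_. 0) S)"
  have u_range: "range u = insert (\<lambda>_. 0) S"
    unfolding u_def using S(2) by (intro range_from_nat_into) auto
  have u_cont: "continuous_map K euclideanreal (u i)" for i
  proof -
    have "u i \<in> insert (\<lambda>_. 0) S" using u_range by blast
    then show ?thesis using coordinates_continuous[OF S(1)] by auto
  qed
  \<comment> \<open>Decoding \<open>n\<close> as a pair lets every function \<open>u i\<close> meet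
    every tolerance \<open>1 / real (Suc m)\<close> at some stage.\<close>
  define small where "small n W \<longleftrightarrow> (\<forall>x\<in>W. \<forall>x'\<in>W. F x = F x' \<longrightarrow>
    \<bar>u (fst (prod_decode n)) x - u (fst (prod_decode n)) x'\<bar> < 1 / real (Suc (snd (prod_decode n))))" for n W
  have "\<exists>W. \<forall>n. (openin K (W n) \<and> F ` W n = topspace C) \<and> (K closure_of W (Suc n) \<subseteq> W n \<and> small n (W (Suc n)))"
  proof (rule dependent_nat_choice)
    show "\<exists>W. openin K W \<and> F ` W = topspace C" using F(3) by blast
    show "\<exists>W'. (openin K W' \<and> F ` W' = topspace C) \<and> K closure_of W' \<subseteq> W \<and> small n W'"
      if "openin K W \<and> F ` W = topspace C" for W n
      using shrink_selection_domain[OF K KH C(1,3) F(1,2) _ _ u_cont, of W "1 / real (Suc (snd (prod_decode n)))"] that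
      unfolding small_def by (simp add: conj_assoc)
  qed
  then obtain W where W: "\<And>n. openin K (W n)" "\<And>n. F ` W n = topspace C"
      "\<And>n. K closure_of W (Suc n) \<subseteq> W n" "\<And>n. small n (W (Suc n))"
    by blast
  have W_closure: "W n \<subseteq> K closure_of W n" for n
    by (intro closure_of_subset openin_subset W(1))
  define L where "L = (\<Inter>n. K closure_of W n)"
  have LW: "x \<in> W n" if "x \<in> L" for x n
    using that W(3) by (auto simp: L_def)
  have L_closed: "closedin K L" unfolding L_def by (intro closedin_INT) auto
  have LK: "x \<in> topspace K" if "x \<in> L" for x
    using that L_closed closedin_subset by blast
  have inj: "x = x'" if x: "x \<in> L" "x' \<in> L" "F x = F x'" for x x'
  proof (rule coordinates_eqI[OF S(1)])
    fix s assume "s \<in> S"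
    then obtain i where i: "s = u i" using u_range by blast
    show "s x = s x'"
    proof (rule ccontr)
      assume "s x \<noteq> s x'"
      then obtain m where m: "1 / real (Suc m) < \<bar>s x - s x'\<bar>"
        by (metis nat_approx_posE right_minus_eq zero_less_abs_iff)
      have "small (prod_encode (i,m)) (W (Suc (prod_encode (i,m))))" by (rule W(4))
      then have "\<bar>u i x - u i x'\<bar> < 1 / real (Suc m)"
        unfolding small_def prod_encode_inverse using x LW by auto
      with m i show False by simp
    qed
  qed (use x LK in auto)
  \<comment> \<open>The fibre over \<open>c\<close> meets every \<open>W n\<close>. Its traces on
    the closures are nested nonempty closed sets, so compactness gives a point of
    \<open>L\<close>.\<close>
  have surj: "\<exists>x\<in>L. F x = c" if c: "c \<in> topspace C" for c
  proof -
    have "closedin C {c}" using C(2) c by (simp add: closedin_Hausdorff_sing_eq)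
    then have "closedin K {x \<in> topspace K. F x \<in> {c}}"
      by (rule closedin_continuous_map_preimage[OF F(1)])
    moreover define D where "D n = K closure_of W n \<inter> {x \<in> topspace K. F x \<in> {c}}" for n
    ultimately have "closedin K (D n)" for n by auto
    moreover have "D n \<noteq> {}" for n
    proof -
      have "c \<in> F ` W n" using W(2) c by simp
      then obtain x where x: "x \<in> W n" "F x = c" by blast
      moreover have "x \<in> topspace K" using openin_subset[OF W(1)] x(1) by blast
      ultimately have "x \<in> D n" using W_closure by (auto simp: D_def)
      then show ?thesis by blast
    qed
    moreover have "decseq D"
      using W(3) W_closure unfolding decseq_Suc_iff D_def by blast
    ultimately have "(\<Inter>n. D n) \<noteq> {}" by (rule compact_space_imp_nest[OF K])
    then show ?thesis by (auto simp: D_def L_def)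
  qed
  then obtain g where g: "\<And>c. c \<in> topspace C \<Longrightarrow> g c \<in> L \<and> F (g c) = c" by metis
  have "continuous_map C K g"
    unfolding continuous_map_closedin
  proof (intro conjI allI impI)
    show "g \<in> topspace C \<rightarrow> topspace K" using g LK by auto
    fix A assume A: "closedin K A"
    have "closed_map K C F" using F(1) K C(2) by (simp add: continuous_imp_closed_map)
    then have "closedin C (F ` (A \<inter> L))"
      using A L_closed by (simp add: closed_map_def closedin_Int)
    moreover have "F ` (A \<inter> L) = {c \<in> topspace C. g c \<in> A}"
    proof
      show "F ` (A \<inter> L) \<subseteq> {c \<in> topspace C. g c \<in> A}"
      proof
        fix c assume "c \<in> F ` (A \<inter> L)"
        then obtain x where x: "x \<in> A" "x \<in> L" "c = F x" by auto
        then have c: "c \<in> topspace C" using F(3) LK by blast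
        with g[OF c] x inj have "g c = x" by blast
        then show "c \<in> {c \<in> topspace C. g c \<in> A}" using x c by simp
      qed
      show "{c \<in> topspace C. g c \<in> A} \<subseteq> F ` (A \<inter> L)" using g by force
    qed
    ultimately show "closedin C {c \<in> topspace C. g c \<in> A}" by simp
  qed
  then show thesis using g that by blast
qed

section \<open>Closure under finitary operations\<close>

text \<open>Arguments are finite sets, but values may be infinite; this allows operations that
  adjoin countably many elements at once.\<close>

definition closed_under :: "('k set \<Rightarrow> 'k set) \<Rightarrow> 'k set \<Rightarrow> bool" where
  "closed_under c S \<longleftrightarrow> (\<forall>F. finite F \<and> F \<subseteq> S \<longrightarrow> c F \<subseteq> S)"

definition fin_hull :: "('k set \<Rightarrow> 'k set) \<Rightarrow> 'k set \<Rightarrow> 'k set" where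
  "fin_hull c A = \<Inter> {S. A \<subseteq> S \<and> closed_under c S}"

lemma fin_hull_subset: "A \<subseteq> fin_hull c A"
  by (auto simp: fin_hull_def)

lemma closed_under_fin_hull: "closed_under c (fin_hull c A)"
  unfolding closed_under_def fin_hull_def by blast

lemma fin_hull_minimal: "A \<subseteq> S \<Longrightarrow> closed_under c S \<Longrightarrow> fin_hull c A \<subseteq> S"
  by (auto simp: fin_hull_def)

lemma fin_hull_mono: "A \<subseteq> B \<Longrightarrow> fin_hull c A \<subseteq> fin_hull c B"
  by (meson closed_under_fin_hull fin_hull_minimal fin_hull_subset subset_trans)

text \<open>A finite subset of the union of a nonempty chain already lies in one member.\<close>

lemma closed_under_Union_chain:
  assumes "\<S> \<noteq> {}" "\<And>S. S \<in> \<S> \<Longrightarrow> closed_under c S"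
    and "\<And>S S'. S \<in> \<S> \<Longrightarrow> S' \<in> \<S> \<Longrightarrow> S \<subseteq> S' \<or> S' \<subseteq> S"
  shows "closed_under c (\<Union>\<S>)"
  unfolding closed_under_def
proof (intro allI impI)
  fix F assume F: "finite F \<and> F \<subseteq> \<Union>\<S>"
  have "subset.chain UNIV \<S>" using assms(3) by (auto simp: subset_chain_def)
  then obtain S where S: "S \<in> \<S>" "F \<subseteq> S"
    using finite_subset_Union_chain[of F \<S>] F assms(1) by blast
  then have "c F \<subseteq> S" using assms(2)[of S] F by (auto simp: closed_under_def)
  then show "c F \<subseteq> \<Union>\<S>" using S(1) by blast
qed

text \<open>Applying the operation to all finite subsets and iterating over the natural numbers
  suffices: a finite subset of the union lies in some stage \<open>H n\<close>, so its value lies in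
  the next.\<close>

lemma countable_fin_hull:
  assumes "countable A" and c: "\<And>F. finite F \<Longrightarrow> F \<subseteq> T \<Longrightarrow> countable (c F) \<and> c F \<subseteq> T" and "A \<subseteq> T"
  shows "countable (fin_hull c A)"
proof -
  define \<Phi> where "\<Phi> S = S \<union> \<Union> (c ` {F. finite F \<and> F \<subseteq> S})" for S
  define H where "H n = (\<Phi> ^^ n) A" for n
  have H: "countable (H n) \<and> H n \<subseteq> T" for n
  proof (induction n)
    case 0
    then show ?case using assms by (simp add: H_def)
  next
    case (Suc n)
    then have "countable {F. finite F \<and> F \<subseteq> H n}" by (intro countable_Collect_finite_subset) auto
    moreover have "countable (c F) \<and> c F \<subseteq> T" if "finite F \<and> F \<subseteq> H n" for F
      using that Suc by (intro c) auto
    moreover have "H (Suc n) = \<Phi> (H n)" by (simp add: H_def)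
    ultimately show ?case using Suc by (auto simp: \<Phi>_def)
  qed
  have "H n \<subseteq> H (Suc n)" for n by (auto simp: H_def \<Phi>_def)
  then have mono: "m \<le> n \<Longrightarrow> H m \<subseteq> H n" for m n by (rule lift_Suc_mono_le)
  have "closed_under c (\<Union>n. H n)"
    unfolding closed_under_def
  proof (intro allI impI)
    fix F assume F: "finite F \<and> F \<subseteq> (\<Union>n. H n)"
    have "subset.chain UNIV (range H)"
      using mono by (auto simp: subset_chain_def) (metis nat_le_linear subsetD)
    then obtain n where "F \<subseteq> H n"
      using finite_subset_Union_chain[of F "range H"] F by blast
    then have "c F \<subseteq> H (Suc n)" using F by (auto simp: H_def \<Phi>_def)
    then show "c F \<subseteq> (\<Union>n. H n)" by blast
  qed
  moreover have "A \<subseteq> (\<Union>n. H n)" using UN_upper[of 0 UNIV H] by (simp add: H_def)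
  ultimately have "fin_hull c A \<subseteq> (\<Union>n. H n)" by (intro fin_hull_minimal)
  then show ?thesis using H by (meson countable_UN countable_subset countableI_type)
qed

section \<open>Weight\<close>

lemma open_base_neighbourhood:
  assumes "open_base X B" "openin X W" "x \<in> W"
  obtains U where "U \<in> B" "x \<in> U" "U \<subseteq> W"
proof -
  have "(arbitrary union_of (\<lambda>U. U \<in> B)) W"
    using assms(1,2) by (simp add: open_base_def)
  then obtain \<U> where "\<U> \<subseteq> B" "\<Union>\<U> = W" by (auto simp: union_of_def)
  then show thesis using assms(3) that by blast
qed

lemma aleph_1_facts: "Card_order aleph_1" "infinite (Field aleph_1)"
  using cardSuc_Card_order[OF natLeq_Card_order] cardSuc_finite[OF natLeq_Card_order]
  by (simp_all add: Field_natLeq)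

text \<open>A proper initial segment of a cardinal order is strictly smaller than the order, and
  anything strictly below the successor of \<open>natLeq\<close> is countable.\<close>

lemma countable_underS_aleph_1:
  assumes "Card_order r" "r \<le>o aleph_1" "a \<in> Field r"
  shows "countable (underS r a)"
proof -
  have "|underS r a| <o r" using assms(1,3) by (rule card_of_underS)
  then have "|underS r a| <o aleph_1" using assms(2) by (rule ordLess_ordLeq_trans)
  then have "|underS r a| \<le>o natLeq"
    using cardSuc_ordLeq_ordLess[OF natLeq_Card_order card_of_Card_order] by blast
  then have "|underS r a| \<le>o |UNIV :: nat set|"
    using ordLeq_ordIso_trans ordIso_symmetric card_of_nat by blast
  then show ?thesis unfolding card_of_ordLeq[symmetric] by (auto intro: countableI)
qed

text \<open>For each pair of basic open sets whose images under some \<open>e \<in> E\<close> are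
  disjoint, one such \<open>e\<close> is chosen. These functions still separate points, and there
  are at most as many of them as pairs.\<close>

lemma coordinates_subfamily_weight:
  assumes w: "weight Y \<le>o aleph_1" and E: "coordinates Y E"
  obtains E\<^sub>0 where "E\<^sub>0 \<subseteq> E" "coordinates Y E\<^sub>0" "|E\<^sub>0| \<le>o aleph_1"
proof -
  obtain B where B: "open_base Y B" "|B| \<le>o aleph_1"
    using w unfolding weight_le_iff by blast
  define sep where "sep = (\<lambda>p e. e \<in> E \<and> e ` fst p \<inter> e ` snd p = {})"
  define \<phi> where "\<phi> p = (SOME e. sep p e)" for p
  define Q where "Q = {p \<in> B \<times> B. \<exists>e. sep p e}"
  have \<phi>: "sep p (\<phi> p)" if "p \<in> Q" for p
    using that someI_ex[of "sep p"] by (auto simp: Q_def \<phi>_def)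
  have sub: "\<phi> ` Q \<subseteq> E" using \<phi> by (auto simp: sep_def)
  have "|B \<times> B| \<le>o aleph_1"
    using aleph_1_facts B(2) by (intro card_of_Times_ordLeq_infinite_Field)
  moreover have "|\<phi> ` Q| \<le>o |B \<times> B|"
    by (rule ordLeq_transitive[OF card_of_image card_of_mono1]) (auto simp: Q_def)
  ultimately have card: "|\<phi> ` Q| \<le>o aleph_1"
    using ordLeq_transitive by blast
  have "coordinates Y (\<phi> ` Q)"
    unfolding coordinates_def
  proof (intro conjI ballI impI)
    show "continuous_map Y euclideanreal e" if "e \<in> \<phi> ` Q" for e
      using that sub coordinates_continuous[OF E] by blast
    fix x y assume xy: "x \<in> topspace Y" "y \<in> topspace Y" and eq: "\<forall>e\<in>\<phi> ` Q. e x = e y"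
    show "x = y"
    proof (rule ccontr)
      assume "x \<noteq> y"
      then obtain e where e: "e \<in> E" "e x \<noteq> e y"
        using coordinates_eqI[OF E xy] by blast
      obtain A A' where A: "open A" "open A'" "e x \<in> A" "e y \<in> A'" "A \<inter> A' = {}"
        using hausdorff[OF e(2)] by metis
      have pre: "openin Y {z \<in> topspace Y. e z \<in> A}" if "open A" for A
        using coordinates_continuous[OF E e(1)] that
        by (intro openin_continuous_map_preimage[where Y=euclideanreal]) auto
      obtain U where U: "U \<in> B" "x \<in> U" "U \<subseteq> {z \<in> topspace Y. e z \<in> A}"
        using open_base_neighbourhood[OF B(1) pre[OF A(1)], of x] xy(1) A(3) by blast
      obtain V where V: "V \<in> B" "y \<in> V" "V \<subseteq> {z \<in> topspace Y. e z \<in> A'}"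
        using open_base_neighbourhood[OF B(1) pre[OF A(2)], of y] xy(2) A(4) by blast
      have "e ` U \<subseteq> A" "e ` V \<subseteq> A'" using U(3) V(3) by auto
      then have "sep (U,V) e" using e(1) A(5) by (auto simp: sep_def)
      then have Q: "(U,V) \<in> Q" using U(1) V(1) by (auto simp: Q_def)
      have "\<phi> (U,V) x \<in> \<phi> (U,V) ` U" "\<phi> (U,V) y \<in> \<phi> (U,V) ` V" using U(2) V(2) by auto
      moreover have "\<phi> (U,V) ` U \<inter> \<phi> (U,V) ` V = {}" using \<phi>[OF Q] by (simp add: sep_def)
      moreover have "\<phi> (U,V) x = \<phi> (U,V) y" using eq Q by blast
      ultimately show False by auto
    qed
  qed
  then show thesis using that sub card by blast
qed

section \<open>Retractions of a Valdivia compact space\<close>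

definition coord_box :: "'a topology \<Rightarrow> ('a \<Rightarrow> real) set \<Rightarrow> (('a \<Rightarrow> real) \<Rightarrow> real) \<Rightarrow> nat \<Rightarrow> 'a set" where
  "coord_box X F a n = {x \<in> topspace X. \<forall>t\<in>F. \<bar>t x - a t\<bar> < 1 / real (Suc n)}"

text \<open>Halving the radius and weakening the inequality yields, for continuous coordinates, a
  closed set inside the open box. This leaves room for a clopen set between the images of the
  two.\<close>

definition half_box :: "'a topology \<Rightarrow> ('a \<Rightarrow> real) set \<Rightarrow> (('a \<Rightarrow> real) \<Rightarrow> real) \<Rightarrow> nat \<Rightarrow> 'a set" where
  "half_box X F a n = {x \<in> topspace X. \<forall>t\<in>F. \<bar>t x - a t\<bar> \<le> 1 / (2 * real (Suc n))}"

lemma closedin_le_level: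
  fixes t :: "'a \<Rightarrow> real"
  assumes "continuous_map X euclideanreal t"
  shows "closedin X {x \<in> topspace X. t x \<le> c}"
  using closedin_continuous_map_preimage[OF assms, of "{..c}"] by simp

lemma openin_box:
  assumes "finite F" "\<And>t. t \<in> F \<Longrightarrow> continuous_map X euclideanreal t"
  shows "openin X (coord_box X F a n)"
proof -
  have "openin X {x \<in> topspace X. \<bar>t x - a t\<bar> < 1 / real (Suc n)}" if "t \<in> F" for t
    by (intro openin_less_level continuous_map_real_abs continuous_map_diff assms(2)[OF that]) simp
  then have "openin X (topspace X \<inter> \<Inter> ((\<lambda>t. {x \<in> topspace X. \<bar>t x - a t\<bar> < 1 / real (Suc n)}) ` F))"
    using assms(1) by (intro openin_Int_Inter) auto
  also have "\<dots> = coord_box X F a n" by (auto simp: coord_box_def)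
  finally show ?thesis .
qed

lemma closedin_abs_le:
  fixes a :: "('a \<Rightarrow> real) \<Rightarrow> real"
  assumes "\<And>t. t \<in> F \<Longrightarrow> continuous_map X euclideanreal t"
  shows "closedin X {x \<in> topspace X. \<forall>t\<in>F. \<bar>t x - a t\<bar> \<le> c}"
proof -
  have "closedin X {x \<in> topspace X. \<bar>t x - a t\<bar> \<le> c}" if "t \<in> F" for t
    by (intro closedin_le_level continuous_map_real_abs continuous_map_diff assms[OF that]) simp
  then have "closedin X (\<Inter> (insert (topspace X) ((\<lambda>t. {x \<in> topspace X. \<bar>t x - a t\<bar> \<le> c}) ` F)))"
    by (intro closedin_Inter) auto
  also have "\<dots> = {x \<in> topspace X. \<forall>t\<in>F. \<bar>t x - a t\<bar> \<le> c}" by auto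
  finally show ?thesis .
qed

lemma half_box_subset_box: "half_box X F a n \<subseteq> coord_box X F a n"
proof -
  have "1 / (2 * real (Suc n)) < 1 / real (Suc n)" by (intro divide_strict_left_mono) auto
  then show ?thesis by (fastforce simp: coord_box_def half_box_def)
qed

lemma exists_rational_centre:
  fixes x :: 'a
  assumes "x \<in> topspace X"
  obtains a where "a \<in> F \<rightarrow>\<^sub>E \<rat>" "x \<in> half_box X F a n"
proof -
  have "\<exists>q\<in>\<rat>. \<bar>t x - q\<bar> \<le> 1 / (2 * real (Suc n))" for t :: "'a \<Rightarrow> real"
  proof -
    obtain q where "q \<in> \<rat>" "t x < q" "q < t x + 1 / (2 * real (Suc n))"
      using Rats_dense_in_real[of "t x" "t x + 1 / (2 * real (Suc n))"] by auto
    then show ?thesis by (intro bexI[of _ q]) auto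
  qed
  then obtain b where b: "\<And>t. b t \<in> \<rat> \<and> \<bar>t x - b t\<bar> \<le> 1 / (2 * real (Suc n))" by metis
  show thesis
    by (rule that[of "restrict b F"]) (use b assms in \<open>auto simp: half_box_def\<close>)
qed

lemma box_neighbourhood:
  assumes "compact_space X" "coordinates X T" "openin X G" "x \<in> G"
  obtains F a n where "finite F" "F \<subseteq> T" "a \<in> F \<rightarrow>\<^sub>E \<rat>" "x \<in> half_box X F a n" "coord_box X F a n \<subseteq> G"
proof -
  obtain F \<epsilon> where F: "finite F" "F \<subseteq> T" "\<epsilon> > 0"
    "\<And>y. y \<in> topspace X \<Longrightarrow> (\<And>t. t \<in> F \<Longrightarrow> \<bar>t y - t x\<bar> \<le> \<epsilon>) \<Longrightarrow> y \<in> G"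
    using coordinates_neighbourhood[OF assms] by metis
  \<comment> \<open>Two points of the box differ in each coordinate by at most twice the radius,
    hence by less than \<open>\<epsilon>\<close>.\<close>
  obtain n where n: "1 / real (Suc n) < \<epsilon> / 2"
    using nat_approx_posE[of "\<epsilon> / 2"] F(3) by (metis half_gt_zero)
  have x: "x \<in> topspace X" using assms(3,4) openin_subset by blast
  obtain a where a: "a \<in> F \<rightarrow>\<^sub>E \<rat>" "x \<in> half_box X F a n"
    using exists_rational_centre[OF x] by metis
  have "coord_box X F a n \<subseteq> G"
  proof
    fix y assume y: "y \<in> coord_box X F a n"
    show "y \<in> G"
    proof (rule F(4))
      show "y \<in> topspace X" using y by (simp add: coord_box_def)
      fix t assume t: "t \<in> F"
      have "\<bar>t y - a t\<bar> < 1 / real (Suc n)" using y t by (simp add: coord_box_def)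
      moreover have "\<bar>t x - a t\<bar> < 1 / real (Suc n)"
        using a(2) half_box_subset_box t by (fastforce simp: coord_box_def)
      ultimately show "\<bar>t y - t x\<bar> \<le> \<epsilon>" using n by linarith
    qed
  qed
  then show thesis using that F(1,2) a by blast
qed

text \<open>When \<open>T\<close> separates points, the coordinate formula determines
  \<open>\<rho>\<close> on the space and makes it idempotent there.\<close>

definition good_retraction :: "'a topology \<Rightarrow> ('a \<Rightarrow> real) set \<Rightarrow> ('a \<Rightarrow> real) set \<Rightarrow> ('a \<Rightarrow> 'a) \<Rightarrow> bool" where
  "good_retraction X T S \<rho> \<longleftrightarrow> continuous_map X X \<rho> \<and>
    (\<forall>t\<in>T. \<forall>x\<in>topspace X. t (\<rho> x) = (if t \<in> S then t x else 0))"

lemma good_retraction_apply: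
  "good_retraction X T S \<rho> \<Longrightarrow> t \<in> T \<Longrightarrow> x \<in> topspace X \<Longrightarrow> t (\<rho> x) = (if t \<in> S then t x else 0)"
  unfolding good_retraction_def by blast

text \<open>
  The operation \<open>c\<close> adjoins to \<open>F\<close> the supports of countably supported points chosen in the nonempty
  rational boxes over \<open>F\<close>. If \<open>S\<close> is closed under it, every \<open>x\<close> is approximated on \<open>S\<close> by points that
  vanish off \<open>S\<close>, so \<open>x\<close> with its coordinates off \<open>S\<close> set to zero is again in \<open>X\<close>.
\<close>

lemma exists_good_retractions:
  assumes X: "compact_space X" and T: "coordinates X T"
    and dense: "X closure_of {x \<in> topspace X. countable {t \<in> T. t x \<noteq> 0}} = topspace X"
  shows "\<exists>c. (\<forall>F. finite F \<longrightarrow> F \<subseteq> T \<longrightarrow> countable (c F) \<and> c F \<subseteq> T) \<and>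
    (\<forall>S. S \<subseteq> T \<longrightarrow> closed_under c S \<longrightarrow> (\<exists>\<rho>. good_retraction X T S \<rho>))"
proof -
  let ?D = "{x \<in> topspace X. countable {t \<in> T. t x \<noteq> 0}}"
  define d where "d F a n = (SOME x. x \<in> ?D \<inter> coord_box X F a n)" for F a n
  define c where "c F = (\<Union>(a,n)\<in>{p \<in> (F \<rightarrow>\<^sub>E \<rat>) \<times> UNIV. coord_box X F (fst p) (snd p) \<noteq> {}}. {t \<in> T. t (d F a n) \<noteq> 0})" for F
  have d: "d F a n \<in> ?D \<inter> coord_box X F a n" if F: "finite F" "F \<subseteq> T" and ne: "coord_box X F a n \<noteq> {}" for F a n
  proof -
    obtain x where x: "x \<in> coord_box X F a n" using ne by blast
    have "x \<in> topspace X" using x by (simp add: coord_box_def)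
    then have "x \<in> X closure_of ?D" using dense by simp
    moreover have "openin X (coord_box X F a n)"
      using F coordinates_continuous[OF T] by (intro openin_box) auto
    ultimately have "\<exists>y. y \<in> ?D \<inter> coord_box X F a n"
      using x unfolding in_closure_of by blast
    then show ?thesis unfolding d_def by (rule someI_ex)
  qed
  show ?thesis
  proof (intro exI[of _ c] conjI allI impI)
    fix F assume F: "finite F" "F \<subseteq> T"
    have "countable ((F \<rightarrow>\<^sub>E \<rat>) \<times> (UNIV :: nat set))"
      using F(1) by (intro countable_SIGMA countable_PiE) (auto intro: countable_rat)
    then have "countable {p \<in> (F \<rightarrow>\<^sub>E \<rat>) \<times> UNIV. coord_box X F (fst p) (snd p) \<noteq> {}}"
      by (rule countable_subset[rotated]) blast
    moreover have "countable {t \<in> T. t (d F a n) \<noteq> 0}" if "coord_box X F a n \<noteq> {}" for a n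
      using d[OF F that] by blast
    then have "countable (case p of (a,n) \<Rightarrow> {t \<in> T. t (d F a n) \<noteq> 0})"
      if "p \<in> {p \<in> (F \<rightarrow>\<^sub>E \<rat>) \<times> UNIV. coord_box X F (fst p) (snd p) \<noteq> {}}" for p
      using that by (simp add: case_prod_beta)
    ultimately have "countable (c F)"
      unfolding c_def by (rule countable_UN)
    then show "countable (c F)" "c F \<subseteq> T" by (auto simp: c_def)
  next
    fix S assume S: "S \<subseteq> T" "closed_under c S"
    have "\<exists>z\<in>topspace X. \<forall>t\<in>T. t z = (if t \<in> S then t x else 0)" if x: "x \<in> topspace X" for x
    proof -
      \<comment> \<open>The desired image of \<open>x\<close> lies in all the sets
        \<open>Z (F,n)\<close>: they require vanishing off \<open>S\<close> and closeness to
        \<open>x\<close> on finite parts of \<open>S\<close>.\<close>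
      define R where "R = {z \<in> topspace X. \<forall>t\<in>T - S. t z = 0}"
      define Z where "Z = (\<lambda>(F,n). {z \<in> topspace X. \<forall>t\<in>F. \<bar>t z - t x\<bar> \<le> 1 / real (Suc n)} \<inter> R)"
      define I where "I = {F. finite F \<and> F \<subseteq> S} \<times> (UNIV :: nat set)"
      have "\<Inter> (Z ` I) \<noteq> {}"
      proof (rule compact_space_directed_Inter[OF X])
        show "Z ` I \<noteq> {}" by (auto simp: I_def)
        have "closedin X R"
          unfolding R_def using coordinates_continuous[OF T]
          by (intro closedin_Collect_equalities) auto
        moreover have "closedin X {z \<in> topspace X. \<forall>t\<in>F. \<bar>t z - t x\<bar> \<le> 1 / real (Suc n)}"
          if "F \<subseteq> S" for F n
          using that S(1) coordinates_continuous[OF T] by (intro closedin_abs_le) auto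
        ultimately show "closedin X A" if "A \<in> Z ` I" for A
          using that by (auto simp: Z_def I_def)
        show "A \<noteq> {}" if A: "A \<in> Z ` I" for A
        proof -
          obtain F n where F: "finite F" "F \<subseteq> S" "A = Z (F,n)" using A by (auto simp: I_def)
          \<comment> \<open>With index \<open>2 * n + 1\<close> the radius is half of
            \<open>1 / real (Suc n)\<close>, which absorbs passing through the centre
            \<open>a\<close>.\<close>
          obtain a where a: "a \<in> F \<rightarrow>\<^sub>E \<rat>" "x \<in> half_box X F a (2 * n + 1)"
            using exists_rational_centre[OF x] by metis
          have xb: "x \<in> coord_box X F a (2 * n + 1)" by (rule subsetD[OF half_box_subset_box a(2)])
          define y where "y = d F a (2 * n + 1)"
          have y: "y \<in> ?D" "y \<in> coord_box X F a (2 * n + 1)"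
            using d[OF F(1), of a "2 * n + 1"] F(2) S(1) xb unfolding y_def by blast+
          have "{t \<in> T. t y \<noteq> 0} \<subseteq> c F"
            unfolding c_def y_def using a(1) xb by (intro UN_upper[of "(a, 2 * n + 1)", THEN subset_trans[rotated]]) auto
          also have "c F \<subseteq> S" using S(2) F by (simp add: closed_under_def)
          finally have "y \<in> R" using y(1) by (auto simp: R_def)
          moreover have "\<bar>t y - t x\<bar> \<le> 1 / real (Suc n)" if "t \<in> F" for t
          proof -
            have "\<bar>t y - a t\<bar> < 1 / real (Suc (2 * n + 1))" "\<bar>t x - a t\<bar> < 1 / real (Suc (2 * n + 1))"
              using that y(2) xb by (auto simp: coord_box_def)
            moreover have "1 / real (Suc (2 * n + 1)) = 1 / real (Suc n) / 2"
              by (simp add: field_simps)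
            moreover have "\<bar>p - q\<bar> \<le> \<delta>" if "\<bar>p - s\<bar> < \<eta>" "\<bar>q - s\<bar> < \<eta>" "\<eta> = \<delta> / 2" for p q s \<eta> \<delta> :: real
              using that by linarith
            ultimately show ?thesis by blast
          qed
          ultimately have "y \<in> A" using y(1) F(3) by (auto simp: Z_def)
          then show ?thesis by blast
        qed
        fix A A' assume "A \<in> Z ` I" "A' \<in> Z ` I"
        then obtain F n F' n' where F: "finite F" "F \<subseteq> S" "A = Z (F,n)" "finite F'" "F' \<subseteq> S" "A' = Z (F',n')"
          by (auto simp: I_def)
        have "1 / real (Suc (max n n')) \<le> 1 / real (Suc n)" "1 / real (Suc (max n n')) \<le> 1 / real (Suc n')"
          by (auto intro!: frac_le)
        then have "Z (F \<union> F', max n n') \<subseteq> A \<inter> A'"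
          unfolding F Z_def by (auto simp del: of_nat_Suc intro: order_trans)
        moreover have "(F \<union> F', max n n') \<in> I" using F by (auto simp: I_def)
        ultimately show "\<exists>A''\<in>Z ` I. A'' \<subseteq> A \<inter> A'" by blast
      qed
      then obtain z where z: "\<And>p. p \<in> I \<Longrightarrow> z \<in> Z p" by blast
      have zR: "z \<in> R" using z[of "({},0)"] by (auto simp: I_def Z_def)
      have "t z = (if t \<in> S then t x else 0)" if t: "t \<in> T" for t
      proof (cases "t \<in> S")
        case True
        have "t z = t x"
        proof (rule ccontr)
          assume "t z \<noteq> t x"
          then obtain n where "1 / real (Suc n) < \<bar>t z - t x\<bar>"
            by (metis nat_approx_posE right_minus_eq zero_less_abs_iff)
          moreover have "({t},n) \<in> I" using True by (simp add: I_def)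
          then have "z \<in> Z ({t},n)" by (rule z)
          ultimately show False by (simp add: Z_def)
        qed
        then show ?thesis using True by simp
      next
        case False
        then show ?thesis using zR t by (simp add: R_def)
      qed
      then show ?thesis using zR by (auto simp: R_def)
    qed
    then obtain \<rho> where \<rho>: "\<And>x. x \<in> topspace X \<Longrightarrow>
        \<rho> x \<in> topspace X \<and> (\<forall>t\<in>T. t (\<rho> x) = (if t \<in> S then t x else 0))"
      by metis
    have "continuous_map X X \<rho>"
    proof (rule continuous_map_coordinatesI[OF X T])
      show "\<rho> x \<in> topspace X" if "x \<in> topspace X" for x using \<rho>[OF that] by blast
      fix t assume t: "t \<in> T"
      have "continuous_map X euclideanreal (\<lambda>x. if t \<in> S then t x else 0)"
        using coordinates_continuous[OF T t] by (cases "t \<in> S") simp_all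
      then show "continuous_map X euclideanreal (\<lambda>x. t (\<rho> x))"
        by (rule continuous_map_eq) (use \<rho> t in auto)
    qed
    then show "\<exists>\<rho>. good_retraction X T S \<rho>"
      unfolding good_retraction_def using \<rho> by blast
  qed
qed

section \<open>Images of Valdivia compact spaces\<close>

definition generated :: "('k set \<Rightarrow> 'e set) \<Rightarrow> 'k set \<Rightarrow> 'e set" where
  "generated \<E> S = \<Union> (\<E> ` {F. finite F \<and> F \<subseteq> S})"

lemma generated_mono: "S \<subseteq> S' \<Longrightarrow> generated \<E> S \<subseteq> generated \<E> S'"
  by (auto simp: generated_def)

lemma generatedI: "finite F \<Longrightarrow> F \<subseteq> S \<Longrightarrow> e \<in> \<E> F \<Longrightarrow> e \<in> generated \<E> S"
  by (auto simp: generated_def)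

lemma countable_generated:
  assumes "countable S" "S \<subseteq> T" "\<And>F. finite F \<Longrightarrow> F \<subseteq> T \<Longrightarrow> countable (\<E> F)"
  shows "countable (generated \<E> S)"
  unfolding generated_def using assms
  by (intro countable_UN countable_Collect_finite_subset) auto

text \<open>Only finite sets \<open>F\<close> feed into \<open>generated\<close>, and each of them
  lies in one member of the chain. This gives continuity at limit steps.\<close>

lemma generated_Union_chain:
  assumes "\<S> \<noteq> {}" and "\<And>S S'. S \<in> \<S> \<Longrightarrow> S' \<in> \<S> \<Longrightarrow> S \<subseteq> S' \<or> S' \<subseteq> S"
  shows "generated \<E> (\<Union>\<S>) = \<Union> (generated \<E> ` \<S>)"
proof
  show "generated \<E> (\<Union>\<S>) \<subseteq> \<Union> (generated \<E> ` \<S>)"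
  proof
    fix e assume "e \<in> generated \<E> (\<Union>\<S>)"
    then obtain F where F: "finite F" "F \<subseteq> \<Union>\<S>" "e \<in> \<E> F" by (auto simp: generated_def)
    have "subset.chain UNIV \<S>" using assms(2) by (auto simp: subset_chain_def)
    then obtain S where "S \<in> \<S>" "F \<subseteq> S"
      using finite_subset_Union_chain[OF F(1,2) assms(1)] by blast
    then have "e \<in> generated \<E> S" using F by (intro generatedI[of F])
    then show "e \<in> \<Union> (generated \<E> ` \<S>)" using \<open>S \<in> \<S>\<close> by blast
  qed
  show "\<Union> (generated \<E> ` \<S>) \<subseteq> generated \<E> (\<Union>\<S>)"
    by (intro UN_least generated_mono Union_upper)
qed

text \<open>Common part of both cases. Closing off under a suitable operation provides, for each
  countable closed \<open>S\<close>, a retraction that leaves all functions of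
  \<open>generated \<E> S\<close> unchanged after \<open>f\<close>; \<open>factor\<close> turns it
  into a map of \<open>Y\<close>. These maps, along a well-order with countable initial segments,
  form a \<open>retractive_sequence\<close>.\<close>

lemma valdivia_compact_if_factorisations:
  fixes f :: "'a \<Rightarrow> 'b" and \<E> :: "('a \<Rightarrow> real) set \<Rightarrow> ('b \<Rightarrow> real) set"
  assumes X: "compact_space X" and T: "coordinates X T"
    and dense: "X closure_of {x \<in> topspace X. countable {t \<in> T. t x \<noteq> 0}} = topspace X"
    and Y: "compact_space Y" "Hausdorff_space Y" "weight Y \<le>o aleph_1"
    and f: "continuous_map X Y f"
    and \<E>_countable: "\<And>F. finite F \<Longrightarrow> F \<subseteq> T \<Longrightarrow> countable (\<E> F)"
    and \<E>_coords: "coordinates Y (generated \<E> T)"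
    and \<E>_range: "\<And>e y. e \<in> generated \<E> T \<Longrightarrow> y \<in> topspace Y \<Longrightarrow> e y \<in> {0..1}"
    and factor: "\<And>S \<rho>. S \<subseteq> T \<Longrightarrow> countable S \<Longrightarrow> good_retraction X T S \<rho> \<Longrightarrow>
      (\<And>e x. e \<in> generated \<E> S \<Longrightarrow> x \<in> topspace X \<Longrightarrow> e (f (\<rho> x)) = e (f x)) \<Longrightarrow>
      \<exists>P. continuous_map Y Y P \<and> (\<forall>e\<in>generated \<E> S. \<forall>y\<in>topspace Y. e (P y) = e y) \<and>
        (\<forall>y\<in>topspace Y. \<forall>y'\<in>topspace Y. (\<forall>e\<in>generated \<E> S. e y = e y') \<longrightarrow> P y = P y')"
  shows "valdivia_compact Y"
proof -
  obtain c\<^sub>1 where c\<^sub>1: "\<And>F. finite F \<Longrightarrow> F \<subseteq> T \<Longrightarrow> countable (c\<^sub>1 F) \<and> c\<^sub>1 F \<subseteq> T"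
    and retr: "\<And>S. S \<subseteq> T \<Longrightarrow> closed_under c\<^sub>1 S \<Longrightarrow> \<exists>\<rho>. good_retraction X T S \<rho>"
    using exists_good_retractions[OF X T dense] by blast
  have "\<exists>C. countable C \<and> C \<subseteq> T \<and> (\<forall>x\<in>topspace X. \<forall>x'\<in>topspace X.
      (\<forall>t\<in>C. t x = t x') \<longrightarrow> e (f x) = e (f x'))" if "e \<in> generated \<E> T" for e
  proof -
    have "continuous_map X euclideanreal (\<lambda>x. e (f x))"
      using continuous_map_compose[OF f coordinates_continuous[OF \<E>_coords that]] by (simp add: o_def)
    then show ?thesis by (rule continuous_map_depends_countable[OF X T])
  qed
  then obtain C where C: "\<And>e. e \<in> generated \<E> T \<Longrightarrow> countable (C e) \<and> C e \<subseteq> T \<and>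
      (\<forall>x\<in>topspace X. \<forall>x'\<in>topspace X. (\<forall>t\<in>C e. t x = t x') \<longrightarrow> e (f x) = e (f x'))"
    by metis
  \<comment> \<open>Besides the supports needed for the retraction, \<open>c\<close> adjoins the
    countably many coordinates on which each \<open>e \<circ> f\<close> with
    \<open>e \<in> \<E> F\<close> depends.\<close>
  define c where "c F = c\<^sub>1 F \<union> (\<Union>e\<in>\<E> F. C e)" for F
  have c: "countable (c F) \<and> c F \<subseteq> T" if F: "finite F" "F \<subseteq> T" for F
  proof -
    have "e \<in> generated \<E> T" if "e \<in> \<E> F" for e using F that by (rule generatedI)
    then show ?thesis
      unfolding c_def using c\<^sub>1[OF F] \<E>_countable[OF F] C by (auto intro!: countable_Un countable_UN)
  qed
  have factor': "\<exists>P. continuous_map Y Y P \<and> (\<forall>e\<in>generated \<E> S. \<forall>y\<in>topspace Y. e (P y) = e y) \<and>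
        (\<forall>y\<in>topspace Y. \<forall>y'\<in>topspace Y. (\<forall>e\<in>generated \<E> S. e y = e y') \<longrightarrow> P y = P y')"
    if S: "S \<subseteq> T" "countable S" "closed_under c S" for S
  proof -
    have "closed_under c\<^sub>1 S" using S(3) by (auto simp: closed_under_def c_def)
    then obtain \<rho> where \<rho>: "good_retraction X T S \<rho>" using retr[OF S(1)] by blast
    show ?thesis
    proof (rule factor[OF S(1,2) \<rho>])
      fix e x assume e: "e \<in> generated \<E> S" and x: "x \<in> topspace X"
      obtain F where F: "finite F" "F \<subseteq> S" "e \<in> \<E> F" using e by (auto simp: generated_def)
      then have "C e \<subseteq> c F" by (auto simp: c_def)
      also have "c F \<subseteq> S" using S(3) F by (simp add: closed_under_def)
      finally have CS: "C e \<subseteq> S" .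
      have "t (\<rho> x) = t x" if "t \<in> C e" for t
      proof -
        have "t \<in> S" "t \<in> T" using that CS S(1) by blast+
        then show ?thesis using good_retraction_apply[OF \<rho> \<open>t \<in> T\<close> x] by simp
      qed
      moreover have "\<rho> x \<in> topspace X"
        using \<rho> x unfolding good_retraction_def continuous_map_def by blast
      moreover have "e \<in> generated \<E> T" by (rule subsetD[OF generated_mono[OF S(1)] e])
      ultimately show "e (f (\<rho> x)) = e (f x)" using C x by blast
    qed
  qed
  obtain E\<^sub>0 where E\<^sub>0: "E\<^sub>0 \<subseteq> generated \<E> T" "coordinates Y E\<^sub>0" "|E\<^sub>0| \<le>o aleph_1"
    using coordinates_subfamily_weight[OF Y(3) \<E>_coords] by blast
  \<comment> \<open>The steps are indexed by the separating functions themselves, in a cardinal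
    order of type at most \<open>aleph_1\<close>.\<close>
  define r where "r = |E\<^sub>0|"
  have r: "Card_order r" "Well_order r" "Field r = E\<^sub>0"
    unfolding r_def by (rule card_of_Card_order card_of_Well_order Field_card_of)+
  have underS_countable: "countable (underS r a)" if "a \<in> E\<^sub>0" for a
    by (rule countable_underS_aleph_1[OF r(1)]) (use E\<^sub>0(3) that r(3) in \<open>simp_all add: r_def\<close>)
  have under_E\<^sub>0: "under r a \<subseteq> E\<^sub>0" "underS r a \<subseteq> E\<^sub>0" for a
    using r(3) by (auto simp: under_def underS_def FieldI1)
  have "\<forall>e\<in>E\<^sub>0. \<exists>F. finite F \<and> F \<subseteq> T \<and> e \<in> \<E> F" using E\<^sub>0(1) unfolding generated_def by blast
  then obtain K where K: "\<And>e. e \<in> E\<^sub>0 \<Longrightarrow> finite (K e) \<and> K e \<subseteq> T \<and> e \<in> \<E> (K e)" by metis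
  define cl where "cl A = fin_hull c (\<Union> (K ` A))" for A
  have closed_T: "closed_under c T" using c unfolding closed_under_def by blast
  have cl: "cl A \<subseteq> T" "countable (cl A)" "closed_under c (cl A)" if "A \<subseteq> E\<^sub>0" "countable A" for A
  proof -
    have K': "\<Union> (K ` A) \<subseteq> T" "countable (\<Union> (K ` A))"
      using K that by (fastforce intro: countable_finite)+
    show "cl A \<subseteq> T" unfolding cl_def by (rule fin_hull_minimal[OF K'(1) closed_T])
    show "countable (cl A)" unfolding cl_def by (rule countable_fin_hull[OF K'(2) c K'(1)])
    show "closed_under c (cl A)" unfolding cl_def by (rule closed_under_fin_hull)
  qed
  have cl_mono: "A \<subseteq> B \<Longrightarrow> cl A \<subseteq> cl B" for A B
    unfolding cl_def by (intro fin_hull_mono) auto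
  have trans: "(x,z) \<in> r" if "(x,y) \<in> r" "(y,z) \<in> r" for x y z
    using r(2) that by (meson order_on_defs(1,2,3) transD well_order_on_def)
  have total: "(x,y) \<in> r \<or> (y,x) \<in> r" if "x \<in> E\<^sub>0" "y \<in> E\<^sub>0" for x y
    using wo_rel.TOTALS[unfolded wo_rel_def, OF r(2)] r(3) that by blast
  have refl: "(x,x) \<in> r" if "x \<in> E\<^sub>0" for x
    using wo_rel.REFL[unfolded wo_rel_def, OF r(2)] r(3) that by (auto simp: refl_on_def)
  define N\<^sub>0 where "N\<^sub>0 = generated \<E> (cl {})"
  define N where "N a = generated \<E> (cl (under r a))" for a
  \<comment> \<open>What is available before step \<open>a\<close> is generated by one countable
    closed set, so \<open>factor'\<close> applies to it. Here \<open>cl\<close> of the open segment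
    is the union of a chain, and the inserted empty set supplies \<open>N\<^sub>0\<close> and keeps
    the chain nonempty.\<close>
  have limit: "generated \<E> (cl (underS r a)) = N\<^sub>0 \<union> \<Union> (N ` underS r a)" for a
  proof -
    define \<S> where "\<S> = cl ` insert {} (under r ` underS r a)"
    have chain: "S \<subseteq> S' \<or> S' \<subseteq> S" if "S \<in> \<S>" "S' \<in> \<S>" for S S'
    proof -
      obtain A where A: "A \<in> insert {} (under r ` underS r a)" "S = cl A"
        using \<open>S \<in> \<S>\<close> unfolding \<S>_def by (elim imageE)
      obtain A' where A': "A' \<in> insert {} (under r ` underS r a)" "S' = cl A'"
        using \<open>S' \<in> \<S>\<close> unfolding \<S>_def by (elim imageE)
      have "A \<subseteq> A' \<or> A' \<subseteq> A"
      proof (cases "A = {} \<or> A' = {}")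
        case False
        then obtain b b' where b: "b \<in> underS r a" "b' \<in> underS r a" "A = under r b" "A' = under r b'"
          using A(1) A'(1) by auto
        then have "(b,b') \<in> r \<or> (b',b) \<in> r" using total under_E\<^sub>0 by blast
        then show ?thesis using trans unfolding b under_def by blast
      qed auto
      then show ?thesis using cl_mono unfolding A(2) A'(2) by blast
    qed
    have "cl (underS r a) = \<Union>\<S>"
    proof
      have "closed_under c (\<Union>\<S>)"
      proof (rule closed_under_Union_chain)
        show "closed_under c S" if "S \<in> \<S>" for S
          using that by (auto simp: \<S>_def cl_def closed_under_fin_hull)
      qed (use chain in \<open>auto simp: \<S>_def\<close>)
      moreover have "\<Union> (K ` underS r a) \<subseteq> \<Union>\<S>"
      proof
        fix t assume "t \<in> \<Union> (K ` underS r a)"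
        then obtain b where b: "b \<in> underS r a" "t \<in> K b" by blast
        then have "b \<in> under r b"
          using refl[OF subsetD[OF under_E\<^sub>0(2) b(1)]] by (simp add: under_def)
        then have "t \<in> cl (under r b)"
          using b(2) fin_hull_subset[of "\<Union> (K ` under r b)" c] by (auto simp: cl_def)
        then show "t \<in> \<Union>\<S>" using b(1) by (auto simp: \<S>_def)
      qed
      ultimately show "cl (underS r a) \<subseteq> \<Union>\<S>"
        unfolding cl_def by (intro fin_hull_minimal)
      have "under r b \<subseteq> underS r a" if "b \<in> underS r a" for b
        using that trans wo_rel.ANTISYM[unfolded wo_rel_def, OF r(2)]
        unfolding under_def underS_def antisym_def by blast
      then show "\<Union>\<S> \<subseteq> cl (underS r a)"
        unfolding \<S>_def using cl_mono by blast
    qed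
    then have "generated \<E> (cl (underS r a)) = \<Union> (generated \<E> ` \<S>)"
      using generated_Union_chain[of \<S> \<E>] chain by (auto simp: \<S>_def)
    also have "\<dots> = N\<^sub>0 \<union> \<Union> (N ` underS r a)"
      by (auto simp: \<S>_def N\<^sub>0_def N_def)
    finally show ?thesis .
  qed
  have under_countable: "countable (under r a)" if "a \<in> E\<^sub>0" for a
    by (rule countable_subset[of _ "insert a (underS r a)"])
      (use underS_countable[OF that] in \<open>auto simp: under_def underS_def\<close>)
  have N\<^sub>0_sub: "N\<^sub>0 \<subseteq> generated \<E> T"
    unfolding N\<^sub>0_def using cl(1)[of "{}"] by (intro generated_mono) auto
  have N_sub: "N a \<subseteq> generated \<E> T" if "a \<in> E\<^sub>0" for a
    unfolding N_def using cl(1)[OF under_E\<^sub>0(1) under_countable[OF that]] by (rule generated_mono)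
  have all_sub: "N\<^sub>0 \<union> \<Union> (N ` E\<^sub>0) \<subseteq> generated \<E> T"
    using N\<^sub>0_sub N_sub by blast
  \<comment> \<open>Each \<open>e\<close> appears by its own step, so the whole sequence inherits
    separation of points from \<open>E\<^sub>0\<close>.\<close>
  have E\<^sub>0_sub: "E\<^sub>0 \<subseteq> \<Union> (N ` E\<^sub>0)"
  proof
    fix e assume e: "e \<in> E\<^sub>0"
    then have "e \<in> under r e" using refl by (simp add: under_def)
    then have "K e \<subseteq> cl (under r e)"
      using fin_hull_subset[of "\<Union> (K ` under r e)" c] by (auto simp: cl_def)
    then have "e \<in> N e" unfolding N_def using K[OF e] by (intro generatedI[of "K e"]) auto
    then show "e \<in> \<Union> (N ` E\<^sub>0)" using e by blast
  qed
  have "\<exists>P. continuous_map Y Y P \<and> (\<forall>e\<in>generated \<E> (cl (underS r a)). \<forall>y\<in>topspace Y. e (P y) = e y) \<and>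
        (\<forall>y\<in>topspace Y. \<forall>y'\<in>topspace Y. (\<forall>e\<in>generated \<E> (cl (underS r a)). e y = e y') \<longrightarrow> P y = P y')"
    if "a \<in> E\<^sub>0" for a
    by (intro factor' cl under_E\<^sub>0 underS_countable that)
  then obtain P where P: "\<And>a. a \<in> E\<^sub>0 \<Longrightarrow> continuous_map Y Y (P a) \<and>
        (\<forall>e\<in>N\<^sub>0 \<union> \<Union> (N ` underS r a). \<forall>y\<in>topspace Y. e (P a y) = e y) \<and>
        (\<forall>y\<in>topspace Y. \<forall>y'\<in>topspace Y. (\<forall>e\<in>N\<^sub>0 \<union> \<Union> (N ` underS r a). e y = e y') \<longrightarrow> P a y = P a y')"
    unfolding limit by metis
  interpret retractive_sequence Y r N\<^sub>0 N P
  proof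
    show "coordinates Y (N\<^sub>0 \<union> \<Union> (N ` Field r))"
      unfolding coordinates_def r(3)
    proof (intro conjI ballI impI)
      show "continuous_map Y euclideanreal e" if "e \<in> N\<^sub>0 \<union> \<Union> (N ` E\<^sub>0)" for e
        using that all_sub by (intro coordinates_continuous[OF \<E>_coords]) blast
      show "y = y'" if "y \<in> topspace Y" "y' \<in> topspace Y" "\<forall>e\<in>N\<^sub>0 \<union> \<Union> (N ` E\<^sub>0). e y = e y'" for y y'
        using that E\<^sub>0_sub by (intro coordinates_eqI[OF E\<^sub>0(2)]) blast+
    qed
    fix a assume a: "a \<in> Field r"
    then have a: "a \<in> E\<^sub>0" by (simp add: r(3))
    show "P a y \<in> topspace Y" if "y \<in> topspace Y" for y
      using P[OF a] that unfolding continuous_map_def by blast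
    show "e (P a y) = e y" if "y \<in> topspace Y" "e \<in> N\<^sub>0 \<union> \<Union> (N ` underS r a)" for y e
      using P[OF a] that by blast
    show "e (P a y) = e (P a y')" if "y \<in> topspace Y" "y' \<in> topspace Y"
      "\<And>d. d \<in> N\<^sub>0 \<union> \<Union> (N ` underS r a) \<Longrightarrow> d y = d y'" for y y' e
    proof -
      have "P a y = P a y'" using P[OF a] that by blast
      then show ?thesis by simp
    qed
    show "continuous_map Y euclideanreal (\<lambda>y. e (P a y))" if "e \<in> N a" for e
    proof -
      have "continuous_map Y euclideanreal e"
        using that N_sub[OF a] by (intro coordinates_continuous[OF \<E>_coords]) blast
      with P[OF a] show ?thesis using continuous_map_compose[of Y Y "P a" euclideanreal e] by (simp add: o_def)
    qed
  qed (fact Y(1) r(2))+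
  show ?thesis
  proof (rule valdivia_compact[OF Y(2)])
    show "countable N\<^sub>0"
      unfolding N\<^sub>0_def using cl[of "{}"] \<E>_countable by (intro countable_generated[of _ T]) auto
    fix a assume "a \<in> Field r"
    then have a: "a \<in> E\<^sub>0" by (simp add: r(3))
    show "countable (N a)"
      unfolding N_def using cl[OF under_E\<^sub>0(1) under_countable[OF a]] \<E>_countable
      by (intro countable_generated[of _ T]) auto
    show "countable (underS r a)" using a by (rule underS_countable)
  next
    show "e y \<in> {0..1}" if "e \<in> N\<^sub>0 \<union> \<Union> (N ` Field r)" "y \<in> topspace Y" for e y
      using that all_sub unfolding r(3) by (intro \<E>_range) blast+
  qed
qed

section \<open>The case of a retraction\<close>

lemma valdivia_compact_retract:
  assumes X: "valdivia_compact X" and Y: "Hausdorff_space Y" "weight Y \<le>o aleph_1"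
    and "retraction_map X Y f"
  shows "valdivia_compact Y"
proof -
  obtain g where f: "continuous_map X Y f" and g: "continuous_map Y X g"
    and fg: "\<And>y. y \<in> topspace Y \<Longrightarrow> f (g y) = y"
    using assms(4) by (auto simp: retraction_map_def retraction_maps_def)
  have XC: "compact_space X" using X by (simp add: valdivia_compact_def)
  have gX: "g y \<in> topspace X" if "y \<in> topspace Y" for y
    using g that unfolding continuous_map_def by blast
  have "f ` topspace X = topspace Y"
    using assms(4) by (rule retraction_imp_surjective_map)
  then have YC: "compact_space Y"
    using image_compactin[of X "topspace X" Y f] XC f by (simp add: compact_space_def)
  obtain T where T: "coordinates X T" "\<And>t x. t \<in> T \<Longrightarrow> x \<in> topspace X \<Longrightarrow> t x \<in> {0..1}"
    "X closure_of {x \<in> topspace X. countable {t \<in> T. t x \<noteq> 0}} = topspace X"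
    using valdivia_compactE[OF X] by blast
  define \<E> :: "('a \<Rightarrow> real) set \<Rightarrow> ('b \<Rightarrow> real) set" where "\<E> F = (\<lambda>t. t \<circ> g) ` F" for F
  have gen: "generated \<E> S = (\<lambda>t. t \<circ> g) ` S" for S
  proof
    show "(\<lambda>t. t \<circ> g) ` S \<subseteq> generated \<E> S"
      using generatedI[of "{t}" S "t \<circ> g" \<E> for t] by (auto simp: \<E>_def)
  qed (auto simp: generated_def \<E>_def)
  show ?thesis
  proof (rule valdivia_compact_if_factorisations[OF XC T(1,3) YC Y f, of \<E>])
    show "countable (\<E> F)" if "finite F" for F
      using that by (simp add: \<E>_def countable_finite)
    show "coordinates Y (generated \<E> T)"
      unfolding coordinates_def gen
    proof (intro conjI ballI impI)
      show "continuous_map Y euclideanreal e" if "e \<in> (\<lambda>t. t \<circ> g) ` T" for e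
        using that continuous_map_compose[OF g coordinates_continuous[OF T(1)]] by auto
      fix y y' assume y: "y \<in> topspace Y" "y' \<in> topspace Y" and eq: "\<forall>e\<in>(\<lambda>t. t \<circ> g) ` T. e y = e y'"
      then have "g y = g y'" by (intro coordinates_eqI[OF T(1)] gX) auto
      then show "y = y'" using fg y by metis
    qed
    show "e y \<in> {0..1}" if "e \<in> generated \<E> T" "y \<in> topspace Y" for e y
      using that T(2) gX by (auto simp: gen simp del: atLeastAtMost_iff)
    fix S \<rho> assume S: "S \<subseteq> T" "good_retraction X T S \<rho>"
      and eq: "\<And>e x. e \<in> generated \<E> S \<Longrightarrow> x \<in> topspace X \<Longrightarrow> e (f (\<rho> x)) = e (f x)"
    have \<rho>: "continuous_map X X \<rho>" using S(2) by (simp add: good_retraction_def)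
    have \<rho>X: "\<rho> x \<in> topspace X" if "x \<in> topspace X" for x
      using \<rho> that unfolding continuous_map_def by blast
    show "\<exists>P. continuous_map Y Y P \<and> (\<forall>e\<in>generated \<E> S. \<forall>y\<in>topspace Y. e (P y) = e y) \<and>
        (\<forall>y\<in>topspace Y. \<forall>y'\<in>topspace Y. (\<forall>e\<in>generated \<E> S. e y = e y') \<longrightarrow> P y = P y')"
    proof (intro exI[of _ "f \<circ> \<rho> \<circ> g"] conjI ballI impI)
      show "continuous_map Y Y (f \<circ> \<rho> \<circ> g)"
        by (intro continuous_map_compose[OF g] continuous_map_compose[OF \<rho> f])
      show "e ((f \<circ> \<rho> \<circ> g) y) = e y" if "e \<in> generated \<E> S" "y \<in> topspace Y" for e y
        using eq[OF that(1) gX[OF that(2)]] fg[OF that(2)] by simp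
      fix y y' assume y: "y \<in> topspace Y" "y' \<in> topspace Y" and e: "\<forall>e\<in>generated \<E> S. e y = e y'"
      \<comment> \<open>Coordinates in \<open>S\<close> agree by assumption, since
        \<open>t \<circ> g\<close> is generated by \<open>{t}\<close>; the others vanish at both
        points.\<close>
      have "\<rho> (g y) = \<rho> (g y')"
      proof (intro coordinates_eqI[OF T(1)] \<rho>X gX y)
        fix t assume "t \<in> T"
        note at = good_retraction_apply[OF S(2) this gX]
        show "t (\<rho> (g y)) = t (\<rho> (g y'))"
          unfolding at[OF y(1)] at[OF y(2)] using e by (auto simp: gen)
      qed
      then show "(f \<circ> \<rho> \<circ> g) y = (f \<circ> \<rho> \<circ> g) y'" by simp
    qed
  qed
qed

section \<open>The case of an open map onto a zero-dimensional space\<close>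

lemma continuous_map_indicator_clopen:
  assumes "openin X Q" "closedin X Q"
  shows "continuous_map X euclideanreal (indicat_real Q)"
  unfolding continuous_map_def
proof (intro conjI allI impI)
  fix U :: "real set"
  have "openin X (topspace X - Q)" using assms(2) by blast
  moreover have "{x \<in> topspace X. indicat_real Q x \<in> U} =
      (if 1 \<in> U then Q else {}) \<union> (if 0 \<in> U then topspace X - Q else {})"
    using openin_subset[OF assms(1)] by (auto simp: indicator_def split: if_splits)
  ultimately show "openin X {x \<in> topspace X. indicat_real Q x \<in> U}"
    using assms(1) by auto
qed auto

text \<open>Indicators of clopen sets between the images of half boxes and boxes serve as functions
  on \<open>Y\<close>. For countable \<open>S\<close>, the induced map from the image of the
  retraction to the quotient is open, so the selection lemma gives a section.\<close>

lemma valdivia_compact_open_image: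
  assumes X: "valdivia_compact X" and Y: "Hausdorff_space Y" "weight Y \<le>o aleph_1" "Y dim_le 0"
    and f: "continuous_map X Y f" "open_map X Y f" "f ` topspace X = topspace Y"
  shows "valdivia_compact Y"
proof -
  have XC: "compact_space X" using X by (simp add: valdivia_compact_def)
  have YC: "compact_space Y"
    using image_compactin[of X "topspace X" Y f] XC f by (simp add: compact_space_def)
  obtain T where T: "coordinates X T" "\<And>t x. t \<in> T \<Longrightarrow> x \<in> topspace X \<Longrightarrow> t x \<in> {0..1}"
    "X closure_of {x \<in> topspace X. countable {t \<in> T. t x \<noteq> 0}} = topspace X"
    using valdivia_compactE[OF X] by blast
  have "\<exists>Q. openin Y Q \<and> closedin Y Q \<and> f ` half_box X F a n \<subseteq> Q \<and> Q \<subseteq> f ` coord_box X F a n"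
    if F: "finite F" "F \<subseteq> T" for F a n
  proof -
    have cont: "continuous_map X euclideanreal t" if "t \<in> F" for t
      using that F(2) coordinates_continuous[OF T(1)] by blast
    have "closedin X (half_box X F a n)"
      unfolding half_box_def using cont by (rule closedin_abs_le)
    then have "compactin Y (f ` half_box X F a n)"
      using closedin_compact_space[OF XC] image_compactin f(1) by blast
    moreover have "openin Y (f ` coord_box X F a n)"
      using f(2) openin_box[OF F(1) cont] by (simp add: open_map_def)
    moreover have "f ` half_box X F a n \<subseteq> f ` coord_box X F a n"
      using half_box_subset_box by (rule image_mono)
    ultimately show ?thesis
      using dim_le_0_clopen_between[OF Y(3)] by metis
  qed
  then obtain q where q: "\<And>F a n. finite F \<Longrightarrow> F \<subseteq> T \<Longrightarrow> openin Y (q F a n) \<and> closedin Y (q F a n) \<and>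
      f ` half_box X F a n \<subseteq> q F a n \<and> q F a n \<subseteq> f ` coord_box X F a n"
    by metis
  define \<E> where "\<E> F = (\<lambda>(a,n). indicat_real (q F a n)) ` ((F \<rightarrow>\<^sub>E \<rat>) \<times> UNIV)" for F
  have \<E>I: "indicat_real (q F a n) \<in> generated \<E> S"
    if "finite F" "F \<subseteq> S" "a \<in> F \<rightarrow>\<^sub>E \<rat>" for F S a n
    by (rule generatedI[OF that(1,2)]) (use that(3) in \<open>auto simp: \<E>_def\<close>)
  have \<E>E: "\<exists>F a n. finite F \<and> F \<subseteq> S \<and> e = indicat_real (q F a n)" if "e \<in> generated \<E> S" for e S
    using that by (auto simp: generated_def \<E>_def)
  have \<E>_cont: "continuous_map Y euclideanreal e" if e: "e \<in> generated \<E> T" for e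
  proof -
    obtain F a n where F: "finite F" "F \<subseteq> T" "e = indicat_real (q F a n)" using \<E>E[OF e] by blast
    show ?thesis
      unfolding F(3) using q[OF F(1,2)] by (intro continuous_map_indicator_clopen) auto
  qed
  show ?thesis
  proof (rule valdivia_compact_if_factorisations[OF XC T(1,3) YC Y(1,2) f(1), of \<E>])
    show "countable (\<E> F)" if "finite F" for F
      unfolding \<E>_def using that
      by (intro countable_image countable_SIGMA countable_PiE) (auto intro: countable_rat)
    show "e y \<in> {0..1}" if "e \<in> generated \<E> T" for e y
      using \<E>E[OF that] by (auto simp: indicator_def)
    show "coordinates Y (generated \<E> T)"
      unfolding coordinates_def
    proof (intro conjI ballI impI)
      show "continuous_map Y euclideanreal e" if "e \<in> generated \<E> T" for e
        using that by (rule \<E>_cont)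
      fix y y' assume y: "y \<in> topspace Y" "y' \<in> topspace Y" and eq: "\<forall>e\<in>generated \<E> T. e y = e y'"
      show "y = y'"
      proof (rule ccontr)
        assume ne: "y \<noteq> y'"
        \<comment> \<open>A box around a preimage of \<open>y\<close> whose image misses
          \<open>y'\<close> yields a clopen set containing \<open>y\<close> but not
          \<open>y'\<close>.\<close>
        have "openin Y (topspace Y - {y'})"
          using Y(1) y(2) by (intro openin_diff) (simp_all add: closedin_Hausdorff_sing_eq)
        then have G: "openin X {x \<in> topspace X. f x \<in> topspace Y - {y'}}"
          using f(1) by (intro openin_continuous_map_preimage)
        have "y \<in> f ` topspace X" using y(1) f(3) by simp
        then obtain x where x: "x \<in> topspace X" "f x = y" by blast
        obtain F a n where F: "finite F" "F \<subseteq> T" "a \<in> F \<rightarrow>\<^sub>E \<rat>" "x \<in> half_box X F a n"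
            "coord_box X F a n \<subseteq> {x \<in> topspace X. f x \<in> topspace Y - {y'}}"
          using box_neighbourhood[OF XC T(1) G, of x] x y(1) ne by auto
        have "y \<in> q F a n" using q[OF F(1,2), of a n] F(4) x(2) by blast
        moreover have "y' \<notin> q F a n" using q[OF F(1,2), of a n] F(5) by blast
        ultimately show False
          using eq \<E>I[OF F(1-3), of n] by (auto simp: indicator_def)
      qed
    qed
    fix S \<rho> assume S: "S \<subseteq> T" "countable S" "good_retraction X T S \<rho>"
      and eq: "\<And>e x. e \<in> generated \<E> S \<Longrightarrow> x \<in> topspace X \<Longrightarrow> e (f (\<rho> x)) = e (f x)"
    have \<rho>: "continuous_map X X \<rho>"
      and t\<rho>: "\<And>t x. t \<in> T \<Longrightarrow> x \<in> topspace X \<Longrightarrow> t (\<rho> x) = (if t \<in> S then t x else 0)"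
      using S(3) good_retraction_apply by (auto simp: good_retraction_def)
    have \<rho>X: "\<rho> x \<in> topspace X" if "x \<in> topspace X" for x
      using \<rho> that unfolding continuous_map_def by blast
    have fX: "f x \<in> topspace Y" if "x \<in> topspace X" for x
      using f(3) that by blast
    define E where "E = generated \<E> S"
    have ET: "E \<subseteq> generated \<E> T" unfolding E_def using S(1) by (rule generated_mono)
    \<comment> \<open>On \<open>K\<close> all coordinates outside \<open>S\<close> vanish, so the
      countable set \<open>S\<close> separates its points.\<close>
    define K where "K = subtopology X (\<rho> ` topspace X)"
    have topK: "topspace K = \<rho> ` topspace X" using \<rho>X by (auto simp: K_def)
    have KC: "compact_space K"
      unfolding K_def using image_compactin[OF _ \<rho>] XC
      by (intro compact_space_subtopology) (simp add: compact_space_def)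
    have KS: "coordinates K S"
      unfolding coordinates_def
    proof (intro conjI ballI impI)
      show "continuous_map K euclideanreal t" if "t \<in> S" for t
        unfolding K_def using that S(1)
        by (intro continuous_map_from_subtopology coordinates_continuous[OF T(1)]) auto
      fix x x' assume "x \<in> topspace K" "x' \<in> topspace K" and eqS: "\<forall>t\<in>S. t x = t x'"
      then obtain w w' where w: "w \<in> topspace X" "x = \<rho> w" "w' \<in> topspace X" "x' = \<rho> w'"
        unfolding topK by blast
      show "x = x'"
        unfolding w
      proof (rule coordinates_eqI[OF T(1) \<rho>X[OF w(1)] \<rho>X[OF w(3)]])
        show "t (\<rho> w) = t (\<rho> w')" if "t \<in> T" for t
          using eqS t\<rho>[OF that w(1)] t\<rho>[OF that w(3)] unfolding w by (cases "t \<in> S") auto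
      qed
    qed
    \<comment> \<open>\<open>\<pi>\<close> is the quotient map determined by \<open>E\<close>, and
      \<open>C\<close> realises the quotient as a compact space of 0-1 valued functions.\<close>
    define \<pi> where "\<pi> y = (\<lambda>e\<in>E. e y)" for y
    define C where "C = subtopology (product_topology (\<lambda>_. euclideanreal) E) (\<pi> ` topspace Y)"
    have \<pi>: "continuous_map Y (product_topology (\<lambda>_. euclideanreal) E) \<pi>"
      unfolding \<pi>_def using ET \<E>_cont by (auto simp: continuous_map_componentwise)
    have \<pi>C: "continuous_map Y C \<pi>"
      unfolding C_def using \<pi> by (auto simp: continuous_map_in_subtopology)
    have topC: "topspace C = \<pi> ` topspace Y"
      using continuous_map_image_subset_topspace[OF \<pi>] by (auto simp: C_def)
    have CC: "compact_space C"
      unfolding C_def using image_compactin[OF _ \<pi>] YC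
      by (intro compact_space_subtopology) (simp add: compact_space_def)
    let ?ev = "\<lambda>(e :: 'b \<Rightarrow> real) (z :: ('b \<Rightarrow> real) \<Rightarrow> real). z e"
    have CE: "coordinates C (?ev ` E)"
      unfolding coordinates_def
    proof (intro conjI ballI impI)
      fix u assume "u \<in> ?ev ` E"
      then show "continuous_map C euclideanreal u"
        unfolding C_def
        by (auto intro!: continuous_map_from_subtopology continuous_map_product_projection)
    next
      fix z z' assume z: "z \<in> topspace C" "z' \<in> topspace C" "\<forall>u\<in>?ev ` E. u z = u z'"
      then obtain y y' where "z = \<pi> y" "z' = \<pi> y'" unfolding topC by blast
      with z(3) show "z = z'" by (auto simp: \<pi>_def fun_eq_iff)
    qed
    have CH: "Hausdorff_space C" using CE by (rule coordinates_imp_Hausdorff_space)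
    have C0: "C dim_le 0"
    proof (rule coordinates_01_imp_dim_le_0[OF CC CE])
      have "z e \<in> {0,1}" if "e \<in> E" "z \<in> topspace C" for e z
      proof -
        obtain y where y: "z = \<pi> y" using \<open>z \<in> topspace C\<close> unfolding topC by blast
        obtain F a n where e: "e = indicat_real (q F a n)"
          using \<E>E[OF \<open>e \<in> E\<close>[unfolded E_def]] by blast
        have "z e = e y" using \<open>e \<in> E\<close> by (simp add: y \<pi>_def)
        also have "\<dots> \<in> {0,1}" unfolding e by (simp add: indicator_def)
        finally show ?thesis .
      qed
      then show "\<forall>u\<in>?ev ` E. \<forall>z\<in>topspace C. u z \<in> {0,1}" by simp
    qed
    define \<Phi> where "\<Phi> = \<pi> \<circ> f"
    have \<Phi>\<rho>: "\<Phi> (\<rho> x) = \<Phi> x" if "x \<in> topspace X" for x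
      using eq that by (auto simp: \<Phi>_def \<pi>_def E_def fun_eq_iff)
    have \<Phi>_cont: "continuous_map K C \<Phi>"
      unfolding K_def \<Phi>_def
      by (intro continuous_map_from_subtopology continuous_map_compose[OF f(1) \<pi>C])
    have \<Phi>_surj: "\<Phi> ` topspace K = topspace C"
    proof -
      have "\<Phi> ` topspace K = \<Phi> ` topspace X"
        unfolding topK image_image using \<Phi>\<rho> by (intro image_cong) auto
      also have "\<dots> = topspace C" unfolding topC f(3)[symmetric] by (simp add: \<Phi>_def image_comp)
      finally show ?thesis .
    qed
    have \<Phi>_open: "open_map K C \<Phi>"
      unfolding open_map_def
    proof (intro allI impI)
      fix G assume G: "openin K G"
      show "openin C (\<Phi> ` G)"
      proof (subst openin_subopen, intro ballI)
        fix z assume "z \<in> \<Phi> ` G"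
        then obtain x where x: "x \<in> G" "z = \<Phi> x" by blast
        have xK: "x \<in> topspace K" using x(1) G openin_subset by blast
        then have xX: "x \<in> topspace X" using \<rho>X by (auto simp: topK)
        obtain F a n where F: "finite F" "F \<subseteq> S" "a \<in> F \<rightarrow>\<^sub>E \<rat>" "x \<in> half_box K F a n"
            "coord_box K F a n \<subseteq> G"
          using box_neighbourhood[OF KC KS G x(1)] by metis
        have FT: "F \<subseteq> T" using F(2) S(1) by blast
        define e where "e = indicat_real (q F a n)"
        have e: "e \<in> E" unfolding e_def E_def by (rule \<E>I[OF F(1-3)])
        \<comment> \<open>The threshold 1/2 expresses the value 1 of the indicator as an open
          condition.\<close>
        define W where "W = {z \<in> topspace C. z e > 1/2}"
        have "openin C W"
          unfolding W_def using e by (intro openin_greater_level coordinates_continuous[OF CE]) auto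
        moreover have "z \<in> W"
        proof -
          have "x \<in> half_box X F a n" using F(4) xX by (simp add: half_box_def)
          then have "f x \<in> q F a n" using q[OF F(1) FT, of a n] by blast
          then have "z e = 1" using e x(2) by (simp add: \<Phi>_def \<pi>_def e_def)
          moreover have "z \<in> topspace C" using xK x(2) \<Phi>_surj by blast
          ultimately show ?thesis by (simp add: W_def)
        qed
        moreover have "W \<subseteq> \<Phi> ` G"
        proof
          fix w assume w: "w \<in> W"
          then obtain y where y: "y \<in> topspace Y" "w = \<pi> y" unfolding W_def topC by blast
          then have "e y > 1/2" using w e by (simp add: W_def \<pi>_def)
          then have "y \<in> q F a n" by (cases "y \<in> q F a n") (auto simp: e_def)
          then obtain x' where x': "x' \<in> coord_box X F a n" "y = f x'"
            using q[OF F(1) FT, of a n] by blast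
          then have x'X: "x' \<in> topspace X" by (simp add: coord_box_def)
          \<comment> \<open>\<open>x'\<close> may lie outside \<open>K\<close>. Since
            \<open>F \<subseteq> S\<close>, \<open>\<rho>\<close> moves it into \<open>K\<close>
            without leaving the box, and by \<open>\<Phi>\<rho>\<close> without changing its image
            in \<open>C\<close>.\<close>
          have "\<bar>t (\<rho> x') - a t\<bar> < 1 / real (Suc n)" if "t \<in> F" for t
          proof -
            have "t \<in> S" "t \<in> T" using that F(2) FT by blast+
            then have "t (\<rho> x') = t x'" using t\<rho>[OF \<open>t \<in> T\<close> x'X] by simp
            then show ?thesis using x'(1) that by (simp add: coord_box_def)
          qed
          moreover have "\<rho> x' \<in> topspace K" using x'X by (simp add: topK)
          ultimately have "\<rho> x' \<in> coord_box K F a n"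
            unfolding coord_box_def by blast
          moreover have "w = \<Phi> (\<rho> x')" using \<Phi>\<rho>[OF x'X] y(2) x'(2) by (simp add: \<Phi>_def)
          ultimately show "w \<in> \<Phi> ` G" using F(5) by blast
        qed
        ultimately show "\<exists>W. openin C W \<and> z \<in> W \<and> W \<subseteq> \<Phi> ` G" by blast
      qed
    qed
    obtain g where g: "continuous_map C K g" "\<And>z. z \<in> topspace C \<Longrightarrow> \<Phi> (g z) = z"
      using dim_le_0_continuous_selection[OF KC CC CH C0 \<Phi>_cont \<Phi>_open \<Phi>_surj KS S(2)] by blast
    have gX: "continuous_map C X g"
      using g(1) unfolding K_def by (rule continuous_map_into_fulltopology)
    have "\<exists>P. continuous_map Y Y P \<and> (\<forall>e\<in>E. \<forall>y\<in>topspace Y. e (P y) = e y) \<and>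
        (\<forall>y\<in>topspace Y. \<forall>y'\<in>topspace Y. (\<forall>e\<in>E. e y = e y') \<longrightarrow> P y = P y')"
    \<comment> \<open>The witness projects to the quotient, lifts by the section \<open>g\<close>
      into \<open>K\<close>, and returns to \<open>Y\<close> by \<open>f\<close>.\<close>
    proof (intro exI[of _ "f \<circ> g \<circ> \<pi>"] conjI ballI impI)
      show "continuous_map Y Y (f \<circ> g \<circ> \<pi>)"
        by (intro continuous_map_compose[OF \<pi>C] continuous_map_compose[OF gX f(1)])
      show "e ((f \<circ> g \<circ> \<pi>) y) = e y" if e: "e \<in> E" and y: "y \<in> topspace Y" for e y
      proof -
        have "\<Phi> (g (\<pi> y)) = \<pi> y" using y topC by (intro g(2)) blast
        then have "\<Phi> (g (\<pi> y)) e = \<pi> y e" by simp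
        then show ?thesis using e by (simp add: \<Phi>_def \<pi>_def)
      qed
      fix y y' assume "\<forall>e\<in>E. e y = e y'"
      then have "\<pi> y = \<pi> y'" by (auto simp: \<pi>_def)
      then show "(f \<circ> g \<circ> \<pi>) y = (f \<circ> g \<circ> \<pi>) y'" by simp
    qed
    then show "\<exists>P. continuous_map Y Y P \<and> (\<forall>e\<in>generated \<E> S. \<forall>y\<in>topspace Y. e (P y) = e y) \<and>
        (\<forall>y\<in>topspace Y. \<forall>y'\<in>topspace Y. (\<forall>e\<in>generated \<E> S. e y = e y') \<longrightarrow> P y = P y')"
      by (simp add: E_def)
  qed
qed

theorem theorem4p4:
  fixes X :: "'a topology" and Y :: "'b topology" and f :: "'a \<Rightarrow> 'b"
  assumes "valdivia_compact X"
    and "Hausdorff_space Y"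
    and "continuous_map X Y f"
    and "retraction_map X Y f \<or>
         (Y dim_le 0 \<and> open_map X Y f \<and> f ` topspace X = topspace Y)"
    and "weight Y \<le>o aleph_1"
  shows "valdivia_compact Y"
  using assms(4)
proof
  assume "retraction_map X Y f"
  with assms(1,2,5) show ?thesis by (rule valdivia_compact_retract)
next
  assume "Y dim_le 0 \<and> open_map X Y f \<and> f ` topspace X = topspace Y"
  then have f: "Y dim_le 0" "open_map X Y f" "f ` topspace X = topspace Y" by blast+
  show ?thesis by (rule valdivia_compact_open_image[OF assms(1,2,5) f(1) assms(3) f(2,3)])
qed

end
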